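(* The Groenevelt-type decomposition algorithm (described in the context) computes a minimizer of the square-sum $W(x)=\sum_{s\in S}x(s)^2$ over an M-convex set $B\cap\mathbb{Z}^S$ (i.e. a decreasingly minimal element of $B\cap\mathbb{Z}^S$) in strongly polynomial time, where $B=B'(p)$ is the integral base-polyhedron defined by an integer-valued supermodular function $p$ on $S$.
   Context: $S$ is a finite non-empty set. For $x\in\mathbb{R}^S$ and $Z\subseteq S$, $\widetilde x(Z):=\sum_{s\in Z}x(s)$; $\chi_Z$ is the characteristic vector of $Z$. A set-function $p:2^S\to\mathbb{Z}\cup\{-\infty\}$ with $p(\emptyset)=0$ is supermodular if $p(X)+p(Y)\le p(X\cap Y)+p(X\cup Y)$ for all $X,Y$ with finite $p$-values; $p(S)$ is assumed finite. $B'(p):=\{x\in\mathbb{R}^S:\widetilde x(S)=p(S),\ \widetilde x(Z)\ge p(Z)\text{ for every }Z\subset S\}$; the set $B\cap\mathbb{Z}^S$ is called an M-convex set. $Q:=\{y\in\mathbb{R}^S:\widetilde y(X)\ge p(X)\ \forall X\subseteq S\}$. An element $m$ of a set $P$ of vectors is decreasingly minimal in $P$ if the vector of its components sorted in non-increasing order is lexicographically smallest among those of elements of $P$. Computational model: $p$ is accessed through an evaluation oracle, and a strongly polynomial submodular function minimization subroutine is available; "strongly polynomial time" means that the number of elementary arithmetic operations (including rounding) and oracle calls is bounded by a polynomial in $|S|$. For $S_+\subseteq S$, the restriction of $B$ to $S_+$ is $B_+:=B'(p_+)$ on $S_+$, where $p_+(X):=p(X)$ for $X\subseteq S_+$. For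 $S_-\subseteq S$, the contraction of $B$ to $S_-$ is $B_-:=B'(p_-)$ on $S_-$, where $p_-(X):=p(X\cup(S-S_-))-p(S-S_-)$ for $X\subseteq S_-$. Groenevelt-type decomposition algorithm on $B\cap\mathbb{Z}^S$: 1. Let $a:=\lfloor p(S)/|S|\rfloor$, $k:=p(S)-a|S|$, and $x:=a\chi_S+\chi_U$ for an arbitrary $U\subset S$ with $|U|=k$. 2. If $x\in B\cap\mathbb{Z}^S$, let $z^*:=x$ and stop. 3. Find a (componentwise) minimal vector $y$ satisfying $y\ge x$ and $y\in Q\cap\mathbb{Z}^S$. 4. Let $S_+$ be the largest subset $X\subseteq S$ with $\widetilde y(X)=p(X)$, and let $S_-:=S\setminus S_+$. 5. Apply the algorithm recursively to $B_+\cap\mathbb{Z}^{S_+}$; let $z^*_+$ be the output. 6. Apply the algorithm recursively to $B_-\cap\mathbb{Z}^{S_-}$; let $z^*_-$ be the output. 7. Define $z^*(s):=z^*_+(s)$ for $s\in S_+$ and $z^*(s):=z^*_-(s)$ for $s\in S_-$, and stop. *)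

theory Defs
  imports Complex_Main "HOL-Library.Extended" "HOL-Library.FuncSet" "HOL-Library.Multiset"
    "HOL-Computational_Algebra.Polynomial"
begin

section \<open>Supermodular functions, base-polyhedra and decreasing minimality\<close>

text \<open>Vectors indexed by a finite set \<open>S\<close> are extensional functions, i.e. elements of
  \<open>S \<rightarrow>\<^sub>E UNIV\<close>; a set-function on \<open>S\<close> is only ever evaluated on subsets of \<open>S\<close>.\<close>

definition supermodular_on :: "'a set \<Rightarrow> ('a set \<Rightarrow> int extended) \<Rightarrow> bool" where
  "supermodular_on S p \<longleftrightarrow>
     p {} = 0 \<and> p S \<noteq> -\<infinity> \<and> (\<forall>X \<subseteq> S. p X \<noteq> \<infinity>) \<and>
     (\<forall>X \<subseteq> S. \<forall>Y \<subseteq> S. p X \<noteq> -\<infinity> \<and> p Y \<noteq> -\<infinity> \<longrightarrow> p X + p Y \<le> p (X \<inter> Y) + p (X \<union> Y))"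

definition submodular_on :: "'a set \<Rightarrow> ('a set \<Rightarrow> int extended) \<Rightarrow> bool" where
  "submodular_on S f \<longleftrightarrow> supermodular_on S (\<lambda>X. - f X)"

definition base_polyhedron :: "'a set \<Rightarrow> ('a set \<Rightarrow> int extended) \<Rightarrow> ('a \<Rightarrow> real) set" where
  "base_polyhedron S p =
     {x \<in> S \<rightarrow>\<^sub>E UNIV. Fin (\<Sum>s\<in>S. x s) = map_extended real_of_int (p S) \<and>
        (\<forall>Z. Z \<subset> S \<longrightarrow> map_extended real_of_int (p Z) \<le> Fin (\<Sum>s\<in>Z. x s))}"

definition upper_polyhedron :: "'a set \<Rightarrow> ('a set \<Rightarrow> int extended) \<Rightarrow> ('a \<Rightarrow> real) set" where
  "upper_polyhedron S p =
     {y \<in> S \<rightarrow>\<^sub>E UNIV. \<forall>X \<subseteq> S. map_extended real_of_int (p X) \<le> Fin (\<Sum>s\<in>X. y s)}"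

text \<open>The integral points \<open>P \<inter> \<int>\<^sup>S\<close> of \<open>P \<subseteq> \<real>\<^sup>S\<close>, as integer-valued vectors.\<close>

definition integer_points :: "'a set \<Rightarrow> ('a \<Rightarrow> real) set \<Rightarrow> ('a \<Rightarrow> int) set" where
  "integer_points S P = {x \<in> S \<rightarrow>\<^sub>E UNIV. (\<lambda>s\<in>S. real_of_int (x s)) \<in> P}"

definition M_convex_set :: "'a set \<Rightarrow> ('a set \<Rightarrow> int extended) \<Rightarrow> ('a \<Rightarrow> int) set" where
  "M_convex_set S p = integer_points S (base_polyhedron S p)"

definition sorted_decreasing :: "'a set \<Rightarrow> ('a \<Rightarrow> 'b::linorder) \<Rightarrow> 'b list" where
  "sorted_decreasing S x = rev (sorted_list_of_multiset (image_mset x (mset_set S)))"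

definition decreasingly_minimal :: "'a set \<Rightarrow> ('a \<Rightarrow> 'b::linorder) set \<Rightarrow> ('a \<Rightarrow> 'b) \<Rightarrow> bool" where
  "decreasingly_minimal S P m \<longleftrightarrow>
     m \<in> P \<and> (\<forall>x\<in>P. lexordp_eq (sorted_decreasing S m) (sorted_decreasing S x))"

definition square_sum :: "'a set \<Rightarrow> ('a \<Rightarrow> int) \<Rightarrow> int" where
  "square_sum S x = (\<Sum>s\<in>S. (x s)\<^sup>2)"


section \<open>The decomposition algorithm\<close>

definition fin_part :: "int extended \<Rightarrow> int" where
  "fin_part e = (case e of Fin v \<Rightarrow> v | _ \<Rightarrow> 0)"

definition contraction ::
  "'a set \<Rightarrow> ('a set \<Rightarrow> int extended) \<Rightarrow> 'a set \<Rightarrow> 'a set \<Rightarrow> int extended" where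
  "contraction S p Sm = (\<lambda>X. p (X \<union> (S - Sm)) - p (S - Sm))"

text \<open>The algorithm leaves two choices open: the set \<open>U\<close> of the start vector and the
  minimal vector above it. They are made by the functions \<open>pick\<close> and \<open>miny\<close>. Different recursive calls
  of one execution have different ground sets, so every execution arises from such functions.\<close>

definition valid_choice :: "('a set \<Rightarrow> nat \<Rightarrow> 'a set) \<Rightarrow> bool" where
  "valid_choice pick \<longleftrightarrow>
     (\<forall>S k. finite S \<and> k < card S \<longrightarrow> pick S k \<subset> S \<and> card (pick S k) = k)"

definition minimal_above ::
  "'a set \<Rightarrow> ('a set \<Rightarrow> int extended) \<Rightarrow> ('a \<Rightarrow> int) \<Rightarrow> ('a \<Rightarrow> int) \<Rightarrow> bool" where
  "minimal_above S p x y \<longleftrightarrow>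
     (let F = {y \<in> integer_points S (upper_polyhedron S p). \<forall>s\<in>S. x s \<le> y s}
      in y \<in> F \<and> (\<forall>y'\<in>F. (\<forall>s\<in>S. y' s \<le> y s) \<longrightarrow> y' = y))"

definition finds_minimal ::
  "('a set \<Rightarrow> ('a set \<Rightarrow> int extended) \<Rightarrow> ('a \<Rightarrow> int) \<Rightarrow> ('a \<Rightarrow> int)) \<Rightarrow> bool" where
  "finds_minimal miny \<longleftrightarrow>
     (\<forall>S p x. finite S \<and> S \<noteq> {} \<and> supermodular_on S p \<and> x \<in> S \<rightarrow>\<^sub>E UNIV \<longrightarrow>
        minimal_above S p x (miny S p x))"

definition start_vector :: "('a set \<Rightarrow> nat \<Rightarrow> 'a set) \<Rightarrow> 'a set \<Rightarrow> int \<Rightarrow> 'a \<Rightarrow> int" where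
  "start_vector pick S v =
     (let a = \<lfloor>real_of_int v / real (card S)\<rfloor>;
          k = v - a * int (card S);
          U = pick S (nat k)
      in (\<lambda>s\<in>S. a + (if s \<in> U then 1 else 0)))"

text \<open>\<open>Sp\<close>, \<open>Sm\<close> stand for \<open>S\<^sub>+\<close>, \<open>S\<^sub>-\<close>. The restriction of \<open>p\<close> to \<open>Sp\<close> is \<open>p\<close> itself, with
  the smaller ground set. The result is \<open>None\<close> exactly if the recursion does not terminate.\<close>

partial_function (option) groenevelt ::
  "('a set \<Rightarrow> nat \<Rightarrow> 'a set) \<Rightarrow>
   ('a set \<Rightarrow> ('a set \<Rightarrow> int extended) \<Rightarrow> ('a \<Rightarrow> int) \<Rightarrow> ('a \<Rightarrow> int)) \<Rightarrow>
   'a set \<Rightarrow> ('a set \<Rightarrow> int extended) \<Rightarrow> ('a \<Rightarrow> int) option" where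
  "groenevelt pick miny S p =
     (let x = start_vector pick S (fin_part (p S)) in
      if x \<in> M_convex_set S p then Some x
      else
        let y = miny S p x;
            Sp = (GREATEST X. X \<subseteq> S \<and> Fin (\<Sum>s\<in>X. y s) = p X);
            Sm = S - Sp
        in Option.bind (groenevelt pick miny Sp p) (\<lambda>zp.
           Option.bind (groenevelt pick miny Sm (contraction S p Sm)) (\<lambda>zm.
           Some (\<lambda>s\<in>S. if s \<in> Sp then zp s else zm s))))"


section \<open>The computational model\<close>

text \<open>A computation is its result together with the number of elementary arithmetic operations
  (including comparison and rounding), oracle calls and subroutine calls that it takes.
  Operations on finite sets that do not involve numbers are free.\<close>

type_synonym 'r counted = "'r \<times> nat"

abbreviation result :: "'r counted \<Rightarrow> 'r" where "result \<equiv> fst"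
abbreviation ops :: "'r counted \<Rightarrow> nat" where "ops \<equiv> snd"

type_synonym 'a set_oracle = "'a set \<Rightarrow> int extended counted"

definition eval_oracle :: "('a set \<Rightarrow> int extended) \<Rightarrow> 'a set_oracle" where
  "eval_oracle p = (\<lambda>X. (p X, 1))"

text \<open>Submodular function minimization as a black box: if evaluating the function takes at most
  \<open>c\<close> operations, then the subroutine takes at most \<open>\<sigma>(|S|)\<close> evaluations and \<open>\<sigma>(|S|)\<close>
  further operations.\<close>

type_synonym 'a sfm_routine = "'a set \<Rightarrow> 'a set_oracle \<Rightarrow> 'a set counted"

definition strongly_polynomial_sfm :: "'a sfm_routine \<Rightarrow> bool" where
  "strongly_polynomial_sfm sfm \<longleftrightarrow>
     (\<exists>\<sigma> :: nat poly. \<forall>S f. finite S \<and> S \<noteq> {} \<and> submodular_on S (\<lambda>X. result (f X)) \<longrightarrow>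
        is_arg_min (\<lambda>X. result (f X)) (\<lambda>X. X \<subseteq> S) (result (sfm S f)) \<and>
        (\<forall>c. (\<forall>X \<subseteq> S. ops (f X) \<le> c) \<longrightarrow> ops (sfm S f) \<le> poly \<sigma> (card S) * (c + 1)))"


section \<open>The implementation of the algorithm\<close>

definition excess :: "'a set_oracle \<Rightarrow> ('a \<Rightarrow> int) \<Rightarrow> 'a set_oracle" where
  "excess q y = (\<lambda>X. (Fin (\<Sum>s\<in>X. y s) - result (q X), ops (q X) + card X + 1))"

text \<open>The maximum of \<open>p(X) - y(X)\<close> over \<open>X \<subseteq> S\<close>. It is nonnegative, since \<open>X = {}\<close> is
  allowed, and it is zero iff \<open>y\<close> lies in the upper polyhedron.\<close>

definition deficit :: "'a sfm_routine \<Rightarrow> 'a set \<Rightarrow> 'a set_oracle \<Rightarrow> ('a \<Rightarrow> int) \<Rightarrow> int counted" where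
  "deficit sfm S q y =
     (let Z = sfm S (excess q y);
          e = excess q y (result Z)
      in (- fin_part (result e), 1 + ops Z + ops e + 1))"

text \<open>If \<open>y\<close> is in the upper polyhedron then the least value to which its component \<open>s\<close> can be
  decreased while keeping it there and keeping \<open>y s \<ge> x s\<close> is \<open>x s\<close> plus the deficit at
  \<open>y(s := x s)\<close>.\<close>

primrec lower_all ::
  "'a sfm_routine \<Rightarrow> 'a set \<Rightarrow> 'a set_oracle \<Rightarrow> ('a \<Rightarrow> int) \<Rightarrow> 'a list \<Rightarrow> ('a \<Rightarrow> int) \<Rightarrow>
   ('a \<Rightarrow> int) counted" where
  "lower_all sfm S q x [] y = (y, 0)"
| "lower_all sfm S q x (s # ss) y =
     (let d = deficit sfm S q (y(s := x s));
          r = lower_all sfm S q x ss (y(s := x s + result d))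
      in (result r, ops d + 1 + ops r))"

text \<open>Adding the deficit of \<open>x\<close> to every component of \<open>x\<close> gives an element of the upper
  polyhedron, since every nonempty set then gains at least the deficit. Its components are then
  lowered greedily, in the order given by \<open>ss\<close>.\<close>

definition greedy_minimal ::
  "'a sfm_routine \<Rightarrow> 'a list \<Rightarrow> 'a set \<Rightarrow> 'a set_oracle \<Rightarrow> ('a \<Rightarrow> int) \<Rightarrow> ('a \<Rightarrow> int) counted" where
  "greedy_minimal sfm ss S q x =
     (let d = deficit sfm S q x;
          r = lower_all sfm S q x ss (\<lambda>s\<in>S. x s + result d)
      in (result r, ops d + card S + ops r))"

text \<open>For \<open>y\<close> in the upper polyhedron, an element \<open>s\<close> is in the largest tight set iff
  it is in some tight set iff decreasing \<open>y s\<close> by one leaves the polyhedron.\<close>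

definition tight_elements ::
  "'a sfm_routine \<Rightarrow> 'a set \<Rightarrow> 'a set_oracle \<Rightarrow> ('a \<Rightarrow> int) \<Rightarrow> 'a set counted" where
  "tight_elements sfm S q y =
     ({s \<in> S. 0 < result (deficit sfm S q (y(s := y s - 1)))},
      \<Sum>s\<in>S. (ops (deficit sfm S q (y(s := y s - 1))) + 2))"

text \<open>Given an oracle \<open>q\<close> and the stored value \<open>c\<close> of \<open>p\<close> at \<open>Sp = S - Sm\<close>, one query to the
  contraction is one query to \<open>q\<close> and one subtraction.\<close>

definition contraction_oracle :: "'a set_oracle \<Rightarrow> 'a set \<Rightarrow> int extended \<Rightarrow> 'a set_oracle" where
  "contraction_oracle q Sp c = (\<lambda>X. (result (q (X \<union> Sp)) - c, ops (q (X \<union> Sp)) + 1))"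

definition valid_enum :: "('a set \<Rightarrow> 'a list) \<Rightarrow> bool" where
  "valid_enum enum \<longleftrightarrow> (\<forall>S. finite S \<longrightarrow> set (enum S) = S \<and> distinct (enum S))"

text \<open>The algorithm \<^const>\<open>groenevelt\<close> with every step carried out through the oracle and the
  subroutine. The components of the start vector sum up to \<open>p(S)\<close>, so it lies in the base-polyhedron
  iff its deficit is at most zero. Operations counted outside of the subprocedures: a query for
  \<open>p(S)\<close>, counting \<open>S\<close>, a division and a rounding for \<open>a\<close>, a multiplication and a subtraction
  for \<open>k\<close>, the \<open>|S|\<close> components of the start vector, the comparison of the deficit with zero, a
  query for \<open>p(Sp)\<close>, and writing the \<open>|S|\<close> components of the result.\<close>

partial_function (option) groenevelt_impl ::
  "'a sfm_routine \<Rightarrow> ('a set \<Rightarrow> nat \<Rightarrow> 'a set) \<Rightarrow> ('a set \<Rightarrow> 'a list) \<Rightarrow>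
   'a set \<Rightarrow> 'a set_oracle \<Rightarrow> ('a \<Rightarrow> int) counted option" where
  "groenevelt_impl sfm pick enum S q =
     (let v = q S;
          x = start_vector pick S (fin_part (result v));
          d = deficit sfm S q x;
          t = ops v + card S + 4 + card S + ops d + 1
      in
      if result d \<le> 0 then Some (x, t)
      else
        let y = greedy_minimal sfm (enum S) S q x;
            T = tight_elements sfm S q (result y);
            Sp = result T;
            Sm = S - Sp;
            c = q Sp
        in Option.bind (groenevelt_impl sfm pick enum Sp q) (\<lambda>zp.
           Option.bind (groenevelt_impl sfm pick enum Sm (contraction_oracle q Sp (result c)))
             (\<lambda>zm.
           Some ((\<lambda>s\<in>S. if s \<in> Sp then result zp s else result zm s),
                 t + ops y + ops T + ops c + ops zp + ops zm + card S))))"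

end

theory Submission
  imports Defs
begin

text \<open>
  Optimality rests on a certificate. If \<open>z\<close> is an integral point of the base-polyhedron and \<open>Z\<close> is a
  set with \<open>z(Z) = p(Z)\<close> that lies between \<open>{s. z s > \<beta>}\<close> and \<open>{s. z s \<ge> \<beta>}\<close>, then for every other
  point \<open>x\<close>
  \<open>(\<Sum>s\<in>S. (z s - \<beta>)\<^sup>+) = p(Z) - \<beta>|Z| \<le> x(Z) - \<beta>|Z| \<le> (\<Sum>s\<in>S. (x s - \<beta>)\<^sup>+)\<close>.
  If there is such a \<open>Z\<close> for every integer \<open>\<beta>\<close> (\<open>level_certified\<close>), then \<open>z\<close> is
  majorized by every \<open>x\<close>. This gives both kinds of minimality at once
  (\<open>level_certified_optimal\<close>): on a bounded range of integers a square is a nonnegative combination of functions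
  \<open>v \<mapsto> (v - \<beta>)\<^sup>+\<close> plus an affine function, and at the first place where two sorted vectors differ, the
  smaller of the two entries is a threshold \<open>\<beta>\<close> that tells them apart.

  The algorithm keeps the certificate (\<open>groenevelt_level_certified\<close>). A start vector with
  values in \<open>{a, a + 1}\<close> is certified by the sets \<open>S\<close> and \<open>{}\<close>. Otherwise, let \<open>T\<close> be the largest
  tight set of \<open>y\<close>. It is a nonempty proper subset of \<open>S\<close>, and outside of \<open>T\<close> the vector \<open>y\<close>
  agrees with the start vector, by the minimality of \<open>y\<close>. Thus \<open>y \<ge> a\<close> on \<open>T\<close> and \<open>y \<le> a + 1\<close> on
  \<open>S - T\<close>. Comparing with \<open>y\<close>, majorization shows that the output on \<open>T\<close> is at least \<open>a\<close> and the
  output on \<open>S - T\<close> is at most \<open>a + 1\<close>. As no integer lies strictly between \<open>a\<close> and \<open>a + 1\<close>, the two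
  certificates can be glued (\<open>level_certified_gluing\<close>): for \<open>\<beta> \<le> a\<close> take \<open>T\<close> together with the set
  for \<open>S - T\<close>, and for \<open>\<beta> \<ge> a + 1\<close> the set for \<open>T\<close>.

  For the running time, the recursion is a binary tree whose leaves partition \<open>S\<close>, so it has at most
  \<open>2|S| - 1\<close> nodes. Each level of contraction adds one operation to a query but removes an
  element from the ground set, so query time plus size of the ground set never grows, and one
  polynomial bounds the work in each node (\<open>groenevelt_impl_simulates\<close>). The subroutine sees an
  oracle together with its costs and may return different minimizers for different costs, but the
  implementation uses only the minimum value, so the same \<open>y\<close> results as with a unit-cost oracle.
\<close>


section \<open>Integral vectors above a supermodular function\<close>

definition upper :: "'a set \<Rightarrow> ('a set \<Rightarrow> int extended) \<Rightarrow> ('a \<Rightarrow> int) \<Rightarrow> bool" where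
  "upper S p y \<longleftrightarrow> (\<forall>X\<subseteq>S. p X \<le> Fin (sum y X))"

definition tight :: "'a set \<Rightarrow> ('a set \<Rightarrow> int extended) \<Rightarrow> ('a \<Rightarrow> int) \<Rightarrow> 'a set \<Rightarrow> bool" where
  "tight S p y X \<longleftrightarrow> X \<subseteq> S \<and> p X = Fin (sum y X)"

lemma upperD: "upper S p y \<Longrightarrow> X \<subseteq> S \<Longrightarrow> p X \<le> Fin (sum y X)"
  by (simp add: upper_def)

lemma upper_Fin_le: "upper S p y \<Longrightarrow> X \<subseteq> S \<Longrightarrow> p X = Fin v \<Longrightarrow> v \<le> sum y X"
  by (metis upper_def less_eq_extended.simps(1))

lemma map_extended_of_int_le_iff:
  "map_extended real_of_int e \<le> Fin (real_of_int v) \<longleftrightarrow> e \<le> Fin v"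
  by (cases e) simp_all

lemma integer_points_upper_iff:
  "y \<in> integer_points S (upper_polyhedron S p) \<longleftrightarrow> y \<in> S \<rightarrow>\<^sub>E UNIV \<and> upper S p y"
proof -
  have "(\<Sum>s\<in>X. (\<lambda>s\<in>S. real_of_int (y s)) s) = real_of_int (sum y X)" if "X \<subseteq> S" for X
    using that by (auto intro!: sum.cong)
  then show ?thesis
    unfolding integer_points_def upper_polyhedron_def upper_def
    by (auto simp flip: map_extended_of_int_le_iff)
qed

lemma M_convex_set_iff:
  "x \<in> M_convex_set S p \<longleftrightarrow> x \<in> S \<rightarrow>\<^sub>E UNIV \<and> upper S p x \<and> p S = Fin (sum x S)"
proof -
  have sums: "(\<Sum>s\<in>X. (\<lambda>s\<in>S. real_of_int (x s)) s) = real_of_int (sum x X)" if "X \<subseteq> S" for X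
    using that by (auto intro!: sum.cong)
  have "Fin (real_of_int (sum x S)) = map_extended real_of_int (p S) \<longleftrightarrow> p S = Fin (sum x S)"
    by (cases "p S") (auto simp flip: of_int_sum)
  then have "x \<in> M_convex_set S p \<longleftrightarrow> x \<in> S \<rightarrow>\<^sub>E UNIV \<and> p S = Fin (sum x S) \<and>
      (\<forall>Z. Z \<subset> S \<longrightarrow> p Z \<le> Fin (sum x Z))"
    unfolding M_convex_set_def integer_points_def base_polyhedron_def
    using sums by (auto simp: psubset_imp_subset simp flip: map_extended_of_int_le_iff)
  also have "\<dots> \<longleftrightarrow> x \<in> S \<rightarrow>\<^sub>E UNIV \<and> upper S p x \<and> p S = Fin (sum x S)"
    unfolding upper_def by (auto simp: subset_iff_psubset_eq)
  finally show ?thesis .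
qed

lemma supermodular_empty: "supermodular_on S p \<Longrightarrow> p {} = Fin 0"
  by (simp add: supermodular_on_def zero_extended_def)

lemma supermodular_ground_set: "supermodular_on S p \<Longrightarrow> \<exists>v. p S = Fin v"
  unfolding supermodular_on_def by (cases "p S") auto

lemma supermodular_Int_Un:
  assumes "supermodular_on S p" "X \<subseteq> S" "Y \<subseteq> S" "p X = Fin a" "p Y = Fin b"
  obtains c d where "p (X \<inter> Y) = Fin c" "p (X \<union> Y) = Fin d" "a + b \<le> c + d"
proof -
  have "p X \<noteq> -\<infinity>" "p Y \<noteq> -\<infinity>"
    using assms(4,5) by auto
  then have "p X + p Y \<le> p (X \<inter> Y) + p (X \<union> Y)"
    using assms(1-3) unfolding supermodular_on_def by blast
  moreover have "X \<inter> Y \<subseteq> S" "X \<union> Y \<subseteq> S"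
    using assms(2,3) by auto
  then have "p (X \<inter> Y) \<noteq> \<infinity>" "p (X \<union> Y) \<noteq> \<infinity>"
    using assms(1) unfolding supermodular_on_def by blast+
  ultimately show ?thesis
    using assms(4,5) that by (cases "p (X \<inter> Y)"; cases "p (X \<union> Y)") auto
qed

lemma supermodularI:
  assumes "p {} = Fin 0" "p S \<noteq> -\<infinity>" "\<And>X. X \<subseteq> S \<Longrightarrow> p X \<noteq> \<infinity>"
    and "\<And>X Y a b. X \<subseteq> S \<Longrightarrow> Y \<subseteq> S \<Longrightarrow> p X = Fin a \<Longrightarrow> p Y = Fin b \<Longrightarrow>
           \<exists>c d. p (X \<inter> Y) = Fin c \<and> p (X \<union> Y) = Fin d \<and> a + b \<le> c + d"
  shows "supermodular_on S p"
proof -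
  have "p X + p Y \<le> p (X \<inter> Y) + p (X \<union> Y)"
    if XY: "X \<subseteq> S" "Y \<subseteq> S" and fin: "p X \<noteq> -\<infinity>" "p Y \<noteq> -\<infinity>" for X Y
  proof -
    obtain a b where "p X = Fin a" "p Y = Fin b"
      using fin assms(3)[OF XY(1)] assms(3)[OF XY(2)]
      by (cases "p X"; cases "p Y") auto
    then show ?thesis
      using assms(4)[OF XY] by fastforce
  qed
  then show ?thesis
    using assms(1-3) by (simp add: supermodular_on_def zero_extended_def)
qed

text \<open>Subtracting a modular function keeps supermodularity. The double negation is the form in which
  submodularity of the function that is minimized unfolds.\<close>

lemma supermodular_excess:
  assumes "finite S" "supermodular_on S p"
  shows "supermodular_on S (\<lambda>X. - (Fin (sum y X) - p X))"
proof (rule supermodularI)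
  have fin: "p X \<noteq> \<infinity>" if "X \<subseteq> S" for X
    using assms(2) that by (simp add: supermodular_on_def)
  show "- (Fin (sum y {}) - p {}) = Fin 0"
    using supermodular_empty[OF assms(2)] by simp
  show "- (Fin (sum y S) - p S) \<noteq> -\<infinity>"
    using supermodular_ground_set[OF assms(2)] by auto
  show "- (Fin (sum y X) - p X) \<noteq> \<infinity>" if "X \<subseteq> S" for X
    using fin[OF that] by (cases "p X") auto
  fix X Y a b
  assume XY: "X \<subseteq> S" "Y \<subseteq> S"
    and ab: "- (Fin (sum y X) - p X) = Fin a" "- (Fin (sum y Y) - p Y) = Fin b"
  have pXY: "p X = Fin (a + sum y X)" "p Y = Fin (b + sum y Y)"
    using ab by (cases "p X"; cases "p Y"; auto)+
  obtain c d where cd: "p (X \<inter> Y) = Fin c" "p (X \<union> Y) = Fin d"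
      "(a + sum y X) + (b + sum y Y) \<le> c + d"
    using supermodular_Int_Un[OF assms(2) XY pXY] .
  have "sum y (X \<union> Y) + sum y (X \<inter> Y) = sum y X + sum y Y"
    using XY assms(1) by (meson finite_subset sum.union_inter)
  then show "\<exists>c d. - (Fin (sum y (X \<inter> Y)) - p (X \<inter> Y)) = Fin c \<and>
      - (Fin (sum y (X \<union> Y)) - p (X \<union> Y)) = Fin d \<and> a + b \<le> c + d"
    using cd by simp
qed

text \<open>Finiteness of \<open>p T\<close> is what makes \<open>p\<close> a legitimate function on the ground set \<open>T\<close>.\<close>

lemma supermodular_restriction:
  assumes "supermodular_on S p" "T \<subseteq> S" "p T = Fin v"
  shows "supermodular_on T p"
  using assms unfolding supermodular_on_def by (auto simp: subset_iff)

lemma supermodular_contraction: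
  assumes sm: "supermodular_on S p" and T: "T \<subseteq> S" "p T = Fin v"
  shows "supermodular_on (S - T) (contraction S p (S - T))"
proof -
  have ST: "S - (S - T) = T" "S - T \<union> T = S"
    using T(1) by auto
  have fin: "p X \<noteq> \<infinity>" if "X \<subseteq> S" for X
    using sm that by (simp add: supermodular_on_def)
  have "supermodular_on (S - T) (\<lambda>X. p (X \<union> T) - Fin v)"
  proof (rule supermodularI)
    show "p ({} \<union> T) - Fin v = Fin 0"
      using T(2) by simp
    show "p ((S - T) \<union> T) - Fin v \<noteq> -\<infinity>"
      using supermodular_ground_set[OF sm] ST(2) by auto
    show "p (X \<union> T) - Fin v \<noteq> \<infinity>" if "X \<subseteq> S - T" for X
      using fin[of "X \<union> T"] that T(1) by (cases "p (X \<union> T)") auto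
    fix X Y a b
    assume XY: "X \<subseteq> S - T" "Y \<subseteq> S - T"
      and ab: "p (X \<union> T) - Fin v = Fin a" "p (Y \<union> T) - Fin v = Fin b"
    have p: "p (X \<union> T) = Fin (a + v)" "p (Y \<union> T) = Fin (b + v)"
      using ab by (cases "p (X \<union> T)"; cases "p (Y \<union> T)"; auto)+
    have sub: "X \<union> T \<subseteq> S" "Y \<union> T \<subseteq> S"
      using XY T(1) by auto
    have eq: "(X \<union> T) \<inter> (Y \<union> T) = (X \<inter> Y) \<union> T" "(X \<union> T) \<union> (Y \<union> T) = (X \<union> Y) \<union> T"
      by auto
    obtain c d where "p ((X \<inter> Y) \<union> T) = Fin c" "p ((X \<union> Y) \<union> T) = Fin d"
        "(a + v) + (b + v) \<le> c + d"
      using supermodular_Int_Un[OF sm sub p] unfolding eq .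
    then show "\<exists>c d. p (X \<inter> Y \<union> T) - Fin v = Fin c \<and> p (X \<union> Y \<union> T) - Fin v = Fin d \<and>
        a + b \<le> c + d"
      by simp
  qed
  then show ?thesis
    by (simp add: contraction_def ST(1) T(2))
qed

text \<open>For tight \<open>X\<close> and \<open>Y\<close> the supermodular inequality and \<open>y(X \<inter> Y) + y(X \<union> Y) = y(X) + y(Y)\<close>
  leave no slack at the intersection or at the union.\<close>

lemma tight_Un:
  assumes "finite S" "supermodular_on S p" "upper S p y" "tight S p y X" "tight S p y Y"
  shows "tight S p y (X \<union> Y)"
proof -
  have XY: "X \<subseteq> S" "Y \<subseteq> S" "p X = Fin (sum y X)" "p Y = Fin (sum y Y)"
    using assms(4,5) by (auto simp: tight_def)
  obtain c d where cd: "p (X \<inter> Y) = Fin c" "p (X \<union> Y) = Fin d" "sum y X + sum y Y \<le> c + d"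
    using supermodular_Int_Un[OF assms(2) XY] .
  have "c \<le> sum y (X \<inter> Y)" "d \<le> sum y (X \<union> Y)"
    using cd(1,2) XY by (auto intro!: upper_Fin_le[OF assms(3)])
  moreover have "sum y (X \<union> Y) + sum y (X \<inter> Y) = sum y X + sum y Y"
    using XY assms(1) by (meson finite_subset sum.union_inter)
  ultimately show ?thesis
    using cd XY by (simp add: tight_def)
qed

lemma union_of_tight_sets:
  assumes "finite S" "supermodular_on S p" "upper S p y"
  shows "tight S p y {s. \<exists>X. tight S p y X \<and> s \<in> X}" (is "tight S p y ?T")
proof -
  have "finite F \<Longrightarrow> (\<forall>X\<in>F. tight S p y X) \<Longrightarrow> tight S p y (\<Union>F)" for F
  proof (induction F rule: finite_induct)
    case empty
    show ?case
      using supermodular_empty[OF assms(2)] by (simp add: tight_def)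
  next
    case (insert X F)
    then show ?case
      using tight_Un[OF assms, of X "\<Union>F"] by simp
  qed
  moreover have "finite {X. tight S p y X}"
    using assms(1) by (rule finite_subset[rotated, OF finite_Pow_iff[THEN iffD2]])
      (auto simp: tight_def)
  ultimately have "tight S p y (\<Union>{X. tight S p y X})"
    by blast
  moreover have "\<Union>{X. tight S p y X} = ?T"
    by auto
  ultimately show ?thesis by simp
qed

lemma largest_tight_set:
  assumes "finite S" "supermodular_on S p" "upper S p y"
  shows "(GREATEST X. X \<subseteq> S \<and> Fin (\<Sum>s\<in>X. y s) = p X) = {s. \<exists>X. tight S p y X \<and> s \<in> X}"
  by (rule Greatest_equality) (use union_of_tight_sets[OF assms] in \<open>auto simp: tight_def\<close>)

lemma sum_fun_upd:
  fixes y :: "'a \<Rightarrow> int"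
  assumes "finite X"
  shows "sum (y(s := v)) X = sum y X + (if s \<in> X then v - y s else 0)"
proof (cases "s \<in> X")
  case True
  have "sum (y(s := v)) (X - {s}) = sum y (X - {s})"
    by (rule sum.cong) auto
  then show ?thesis
    using True assms by (simp add: sum.remove[where x = s])
next
  case False
  then show ?thesis
    by (auto intro: sum.cong)
qed

text \<open>A componentwise minimal vector is one that cannot be lowered at any single component: lowering
  \<open>y s\<close> by one is blocked either by \<open>x s\<close> or by a tight set through \<open>s\<close>, and conversely a smaller
  vector that differs at \<open>s\<close> would violate the constraint of that tight set.\<close>

lemma minimal_above_iff:
  assumes fin: "finite S"
  shows "minimal_above S p x y \<longleftrightarrow>
    y \<in> S \<rightarrow>\<^sub>E UNIV \<and> upper S p y \<and> (\<forall>s\<in>S. x s \<le> y s) \<and>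
    (\<forall>s\<in>S. y s = x s \<or> (\<exists>X. tight S p y X \<and> s \<in> X))"
    (is "_ \<longleftrightarrow> ?ext \<and> ?up \<and> ?ge \<and> ?tight")
proof
  assume min: "minimal_above S p x y"
  then have y: ?ext ?up ?ge
    by (auto simp: minimal_above_def integer_points_upper_iff)
  have "\<exists>X. tight S p y X \<and> s \<in> X" if s: "s \<in> S" "y s \<noteq> x s" for s
  proof (rule ccontr)
    assume none: "\<nexists>X. tight S p y X \<and> s \<in> X"
    have "upper S p (y(s := y s - 1))"
      unfolding upper_def
    proof (intro allI impI)
      fix X assume X: "X \<subseteq> S"
      then have "p X \<le> Fin (sum y X)" "s \<in> X \<Longrightarrow> p X \<noteq> Fin (sum y X)"
        using y(2) none by (auto simp: upper_def tight_def)
      then show "p X \<le> Fin (sum (y(s := y s - 1)) X)"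
        using finite_subset[OF X fin] by (cases "p X") (auto simp: sum_fun_upd simp del: fun_upd_apply)
    qed
    moreover have "y(s := y s - 1) \<in> S \<rightarrow>\<^sub>E UNIV"
      using y(1) s(1) by (auto simp: PiE_def extensional_def)
    moreover have "\<forall>t\<in>S. x t \<le> (y(s := y s - 1)) t"
      using y(3) s by force
    ultimately have "y(s := y s - 1) = y"
      using min unfolding minimal_above_def Let_def by (auto simp: integer_points_upper_iff)
    then show False
      by (auto dest: fun_cong[where x = s])
  qed
  then show "?ext \<and> ?up \<and> ?ge \<and> ?tight"
    using y by auto
next
  assume y: "?ext \<and> ?up \<and> ?ge \<and> ?tight"
  have "y' = y" if y': "y' \<in> S \<rightarrow>\<^sub>E UNIV" "upper S p y'" "\<forall>s\<in>S. x s \<le> y' s"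
    and le: "\<forall>s\<in>S. y' s \<le> y s" for y'
  proof -
    have "y' s = y s" if s: "s \<in> S" for s
    proof (rule ccontr)
      assume "y' s \<noteq> y s"
      then have lt: "y' s < y s" "x s < y s"
        using le y'(3) s by force+
      then obtain X where X: "tight S p y X" "s \<in> X"
        using y s by force
      then have XS: "X \<subseteq> S" "finite X"
        using fin finite_subset by (auto simp: tight_def)
      have "sum y' X < sum y X"
        using XS le lt(1) X(2) by (intro sum_strict_mono_ex1) auto
      moreover have "sum y X \<le> sum y' X"
        using upper_Fin_le[OF y'(2) XS(1)] X(1) by (simp add: tight_def)
      ultimately show False by simp
    qed
    then show ?thesis
      using y y'(1) by (meson PiE_ext)
  qed
  then show "minimal_above S p x y"
    using y by (auto simp: minimal_above_def integer_points_upper_iff)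
qed

section \<open>A certificate for least majorization\<close>

text \<open>These sums, over all thresholds \<open>\<beta>\<close>, describe the majorization order on integral vectors with equal
  component sums.\<close>

definition positive_part_sum :: "'a set \<Rightarrow> int \<Rightarrow> ('a \<Rightarrow> int) \<Rightarrow> int" where
  "positive_part_sum S \<beta> x = (\<Sum>s\<in>S. max (x s - \<beta>) 0)"

text \<open>For \<open>z s = \<beta>\<close> membership of \<open>s\<close> in the tight set is left free, because such \<open>s\<close> contributes
  nothing to the sum of the positive parts. This freedom is what the gluing argument needs.\<close>

definition level_certified :: "'a set \<Rightarrow> ('a set \<Rightarrow> int extended) \<Rightarrow> ('a \<Rightarrow> int) \<Rightarrow> bool" where
  "level_certified S p z \<longleftrightarrow> z \<in> M_convex_set S p \<and>
     (\<forall>\<beta>. \<exists>Z. tight S p z Z \<and> {s \<in> S. \<beta> < z s} \<subseteq> Z \<and> Z \<subseteq> {s \<in> S. \<beta> \<le> z s})"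

text \<open>The set \<open>Z\<close> for the threshold \<open>\<beta>\<close> turns the sum for \<open>z\<close> into \<open>p(Z) - \<beta>|Z|\<close>, which only lower bounds
  on \<open>x\<close> are needed to compare with. The gluing argument applies this to \<open>y\<close> on \<open>S - T\<close>, which is in
  general not a base of the contraction.\<close>

lemma level_certified_least_majorized:
  assumes "finite S" "level_certified S p z" "upper S p x"
  shows "positive_part_sum S \<beta> z \<le> positive_part_sum S \<beta> x"
proof -
  obtain Z where Z: "tight S p z Z" "{s \<in> S. \<beta> < z s} \<subseteq> Z" "Z \<subseteq> {s \<in> S. \<beta> \<le> z s}"
    using assms(2) unfolding level_certified_def by blast
  have ZS: "Z \<subseteq> S"
    using Z(1) by (simp add: tight_def)
  have "positive_part_sum S \<beta> z = (\<Sum>s\<in>Z. max (z s - \<beta>) 0)"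
    unfolding positive_part_sum_def
    using assms(1) ZS Z(2) by (intro sum.mono_neutral_right) auto
  also have "\<dots> = (\<Sum>s\<in>Z. z s - \<beta>)"
    using Z(3) by (intro sum.cong) auto
  also have "\<dots> \<le> (\<Sum>s\<in>Z. x s - \<beta>)"
    using upper_Fin_le[OF assms(3) ZS] Z(1) by (simp add: tight_def sum_subtractf)
  also have "\<dots> \<le> (\<Sum>s\<in>Z. max (x s - \<beta>) 0)"
    by (intro sum_mono) simp
  also have "\<dots> \<le> positive_part_sum S \<beta> x"
    unfolding positive_part_sum_def
    using assms(1) ZS by (intro sum_mono2) auto
  finally show ?thesis .
qed

text \<open>The second difference of \<open>v \<mapsto> v\<^sup>2\<close> is constantly 2, so each threshold above \<open>L\<close> gets weight 2.\<close>

lemma square_as_positive_parts: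
  fixes L v M :: int
  assumes "L \<le> v" "v \<le> M"
  shows "v\<^sup>2 = L\<^sup>2 + (2 * L + 1) * (v - L) + 2 * (\<Sum>\<beta>\<in>{L<..M}. max (v - \<beta>) 0)"
proof -
  have "(\<Sum>\<beta>\<in>{L<..M}. max (v - \<beta>) 0) = (\<Sum>\<beta>\<in>{L<..v}. v - \<beta>)"
    using assms(2) by (intro sum.mono_neutral_cong_right) auto
  moreover have "v\<^sup>2 = L\<^sup>2 + (2 * L + 1) * (v - L) + 2 * (\<Sum>\<beta>\<in>{L<..v}. v - \<beta>)"
    using assms(1)
  proof (induction v rule: int_ge_induct)
    case base
    show ?case by simp
  next
    case (step v)
    have "{L<..v + 1} = insert (v + 1) {L<..v}"
      using step.hyps by auto
    then have "(\<Sum>\<beta>\<in>{L<..v + 1}. v + 1 - \<beta>) = (\<Sum>\<beta>\<in>{L<..v}. (v - \<beta>) + 1)"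
      by (simp add: algebra_simps)
    also have "\<dots> = (\<Sum>\<beta>\<in>{L<..v}. v - \<beta>) + (v - L)"
      using step.hyps by (simp add: sum.distrib)
    finally show ?case
      using step.IH by (simp add: power2_eq_square algebra_simps)
  qed
  ultimately show ?thesis by simp
qed

lemma square_sum_mono_majorized:
  assumes "finite S" "sum z S = sum x S"
    and "\<And>\<beta>. positive_part_sum S \<beta> z \<le> positive_part_sum S \<beta> x"
  shows "square_sum S z \<le> square_sum S x"
proof -
  \<comment> \<open>The inserted 0 only guarantees nonempty sets when \<open>S\<close> is empty.\<close>
  define L where "L = Min (insert 0 (z ` S \<union> x ` S))"
  define M where "M = Max (insert 0 (z ` S \<union> x ` S))"
  have LM: "L \<le> z s" "z s \<le> M" "L \<le> x s" "x s \<le> M" if "s \<in> S" for s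
    using that assms(1) unfolding L_def M_def by auto
  have expand: "square_sum S y = (\<Sum>s\<in>S. L\<^sup>2 + (2 * L + 1) * (y s - L)) +
      2 * (\<Sum>\<beta>\<in>{L<..M}. positive_part_sum S \<beta> y)"
    if "\<And>s. s \<in> S \<Longrightarrow> L \<le> y s" "\<And>s. s \<in> S \<Longrightarrow> y s \<le> M" for y
  proof -
    have "square_sum S y =
        (\<Sum>s\<in>S. L\<^sup>2 + (2 * L + 1) * (y s - L) + 2 * (\<Sum>\<beta>\<in>{L<..M}. max (y s - \<beta>) 0))"
      unfolding square_sum_def using that square_as_positive_parts by (intro sum.cong) auto
    also have "\<dots> = (\<Sum>s\<in>S. L\<^sup>2 + (2 * L + 1) * (y s - L)) +
        2 * (\<Sum>s\<in>S. \<Sum>\<beta>\<in>{L<..M}. max (y s - \<beta>) 0)"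
      by (simp add: sum.distrib sum_distrib_left)
    also have "(\<Sum>s\<in>S. \<Sum>\<beta>\<in>{L<..M}. max (y s - \<beta>) 0) = (\<Sum>\<beta>\<in>{L<..M}. positive_part_sum S \<beta> y)"
      unfolding positive_part_sum_def by (rule sum.swap)
    finally show ?thesis .
  qed
  have "(\<Sum>s\<in>S. L\<^sup>2 + (2 * L + 1) * (y s - L)) =
      int (card S) * L\<^sup>2 + (2 * L + 1) * (sum y S - int (card S) * L)" for y
    by (simp add: sum.distrib sum_subtractf flip: sum_distrib_left)
  moreover have "(\<Sum>\<beta>\<in>{L<..M}. positive_part_sum S \<beta> z) \<le> (\<Sum>\<beta>\<in>{L<..M}. positive_part_sum S \<beta> x)"
    using assms(3) by (rule sum_mono)
  ultimately show ?thesis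
    using expand[of z] expand[of x] LM assms(2) by simp
qed

text \<open>At the first difference \<open>z \<noteq> x\<close>, suppose \<open>z > x\<close>. All later entries of the second
  list are at most \<open>x\<close>, so the threshold \<open>\<beta> = x\<close> gives zero on the right and a positive
  sum on the left.\<close>

lemma lexordp_eq_if_majorized:
  fixes zs xs :: "int list"
  assumes "length zs = length xs" "sorted (rev xs)"
    and "\<And>\<beta>. (\<Sum>v\<leftarrow>zs. max (v - \<beta>) 0) \<le> (\<Sum>v\<leftarrow>xs. max (v - \<beta>) 0)"
  shows "lexordp_eq zs xs"
  using assms
proof (induction zs xs rule: list_induct2)
  case Nil
  show ?case by simp
next
  case (Cons z zs x xs)
  show ?case
  proof (cases z x rule: linorder_cases)
    case less
    then show ?thesis by simp
  next
    case equal
    have "lexordp_eq zs xs"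
      using Cons.prems by (intro Cons.IH) (auto simp: sorted_append equal)
    then show ?thesis
      by (simp add: equal)
  next
    case greater
    have "(\<Sum>v\<leftarrow>xs. max (v - x) 0) = (\<Sum>v\<leftarrow>xs. 0)"
      using Cons.prems(1) by (intro arg_cong[where f = sum_list] map_cong) (auto simp: sorted_append)
    moreover have "0 \<le> (\<Sum>v\<leftarrow>zs. max (v - x) 0)"
      by (rule sum_list_nonneg) auto
    ultimately show ?thesis
      using Cons.prems(2)[of x] greater by simp
  qed
qed

lemma sum_list_sorted_decreasing:
  fixes g :: "'b::linorder \<Rightarrow> int"
  shows "(\<Sum>v\<leftarrow>sorted_decreasing S y. g v) = (\<Sum>s\<in>S. g (y s))"
proof -
  have "(\<Sum>v\<leftarrow>sorted_decreasing S y. g v) = sum_mset (image_mset g (mset (sorted_decreasing S y)))"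
    by (simp flip: sum_mset_sum_list)
  also have "mset (sorted_decreasing S y) = image_mset y (mset_set S)"
    by (simp add: sorted_decreasing_def)
  finally show ?thesis
    by (simp add: sum_unfold_sum_mset multiset.map_comp comp_def)
qed

lemma length_sorted_decreasing: "length (sorted_decreasing S y) = card S"
proof -
  have "length (sorted_decreasing S y) = size (mset (sorted_decreasing S y))"
    by simp
  also have "mset (sorted_decreasing S y) = image_mset y (mset_set S)"
    by (simp add: sorted_decreasing_def)
  finally show ?thesis by simp
qed

proposition level_certified_optimal:
  assumes "finite S" "level_certified S p z"
  shows "is_arg_min (square_sum S) (\<lambda>x. x \<in> M_convex_set S p) z"
    and "decreasingly_minimal S (M_convex_set S p) z"
proof -
  have z: "z \<in> M_convex_set S p"
    using assms(2) by (simp add: level_certified_def)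
  have maj: "positive_part_sum S \<beta> z \<le> positive_part_sum S \<beta> x" "sum z S = sum x S"
    if "x \<in> M_convex_set S p" for x \<beta>
    using that z level_certified_least_majorized[OF assms] by (auto simp: M_convex_set_iff)
  show "is_arg_min (square_sum S) (\<lambda>x. x \<in> M_convex_set S p) z"
    using z square_sum_mono_majorized[OF assms(1) maj(2) maj(1)] by (simp add: is_arg_min_linorder)
  have "lexordp_eq (sorted_decreasing S z) (sorted_decreasing S x)"
    if x: "x \<in> M_convex_set S p" for x
  proof (rule lexordp_eq_if_majorized)
    show "sorted (rev (sorted_decreasing S x))"
      by (simp add: sorted_decreasing_def)
    show "(\<Sum>v\<leftarrow>sorted_decreasing S z. max (v - \<beta>) 0) \<le> (\<Sum>v\<leftarrow>sorted_decreasing S x. max (v - \<beta>) 0)"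
      for \<beta>
      using maj(1)[OF x] by (simp add: sum_list_sorted_decreasing positive_part_sum_def)
  qed (simp add: length_sorted_decreasing)
  then show "decreasingly_minimal S (M_convex_set S p) z"
    using z by (simp add: decreasingly_minimal_def)
qed

section \<open>Correctness of the decomposition\<close>

lemma start_vector_properties:
  fixes v :: int
  assumes "valid_choice pick" "finite S" "S \<noteq> {}"
  defines "x \<equiv> start_vector pick S v" and "a \<equiv> v div int (card S)"
  shows "x \<in> S \<rightarrow>\<^sub>E UNIV" "sum x S = v" "\<forall>s\<in>S. a \<le> x s \<and> x s \<le> a + 1"
proof -
  define U where "U = pick S (nat (v mod int (card S)))"
  have "card S > 0"
    using assms(2,3) by (simp add: card_gt_0_iff)
  then have U: "U \<subset> S" "int (card U) = v mod int (card S)"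
    using assms(1,2) unfolding valid_choice_def U_def by (auto simp: nat_less_iff)
  have floor: "\<lfloor>real_of_int v / real (card S)\<rfloor> = a"
    using floor_divide_of_int_eq[of v "int (card S)"] by (simp add: a_def)
  have k: "v - a * int (card S) = v mod int (card S)"
    by (simp add: a_def minus_div_mult_eq_mod)
  have x: "x = (\<lambda>s\<in>S. a + (if s \<in> U then 1 else 0))"
    unfolding x_def start_vector_def Let_def floor k U_def ..
  show "x \<in> S \<rightarrow>\<^sub>E UNIV" "\<forall>s\<in>S. a \<le> x s \<and> x s \<le> a + 1"
    by (auto simp: x)
  have "sum x S = (\<Sum>s\<in>S. a) + (\<Sum>s\<in>S. if s \<in> U then 1 else 0)"
    by (simp add: x sum.distrib)
  also have "\<dots> = a * int (card S) + int (card U)"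
    using U(1) assms(2) by (simp add: sum.If_cases Int_absorb1 psubset_imp_subset)
  also have "\<dots> = v"
    by (simp add: U(2) a_def)
  finally show "sum x S = v" .
qed

lemma level_certified_near_uniform:
  assumes "finite S" "supermodular_on S p" "x \<in> M_convex_set S p"
    and "\<forall>s\<in>S. a \<le> x s \<and> x s \<le> a + 1"
  shows "level_certified S p x"
proof -
  have "\<exists>Z. tight S p x Z \<and> {s \<in> S. \<beta> < x s} \<subseteq> Z \<and> Z \<subseteq> {s \<in> S. \<beta> \<le> x s}" for \<beta>
  proof (cases "\<beta> \<le> a")
    case True
    then show ?thesis
      using assms(3,4) by (intro exI[of _ S]) (force simp: tight_def M_convex_set_iff)
  next
    case False
    then show ?thesis
      using assms(4) supermodular_empty[OF assms(2)]
      by (intro exI[of _ "{}"]) (force simp: tight_def)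
  qed
  then show ?thesis
    using assms(3) by (simp add: level_certified_def)
qed

lemma sum_split_if:
  fixes f g :: "'a \<Rightarrow> int"
  assumes "finite X"
  shows "(\<Sum>s\<in>X. if s \<in> T then f s else g s) = sum f (X \<inter> T) + sum g (X - T)"
proof -
  have "X \<inter> - T = X - T" by auto
  then show ?thesis
    using assms by (simp add: sum.If_cases)
qed

text \<open>The vector \<open>y\<close> serves only to bound the two parts: it is a base of the restriction to \<open>T\<close>
  with values at least \<open>a\<close>, and it satisfies the lower bounds of the contraction with values at most
  \<open>a + 1\<close>. Certificates of the parts transfer to \<open>S\<close> because tight sets of the restriction stay
  tight, and tight sets of the contraction become tight after adding \<open>T\<close>.\<close>

lemma level_certified_gluing:
  assumes fin: "finite S" and sm: "supermodular_on S p"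
    and y: "upper S p y" and T: "tight S p y T"
    and lower: "\<forall>s\<in>T. a \<le> y s" and high: "\<forall>s\<in>S - T. y s \<le> a + 1"
    and zp: "level_certified T p zp"
    and zm: "level_certified (S - T) (contraction S p (S - T)) zm"
  shows "level_certified S p (\<lambda>s\<in>S. if s \<in> T then zp s else zm s)" (is "level_certified S p ?z")
proof -
  have TS: "T \<subseteq> S" and pT: "p T = Fin (sum y T)" and finT: "finite T"
    using T fin finite_subset by (auto simp: tight_def)
  have compl: "S - (S - T) = T"
    using TS by auto
  have pm: "contraction S p (S - T) X = p (X \<union> T) - Fin (sum y T)" for X
    by (simp add: contraction_def compl pT)
  have zpB: "upper T p zp" "p T = Fin (sum zp T)"
    using zp by (auto simp: level_certified_def M_convex_set_iff)
  have zmB: "upper (S - T) (contraction S p (S - T)) zm"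
      "contraction S p (S - T) (S - T) = Fin (sum zm (S - T))"
    using zm by (auto simp: level_certified_def M_convex_set_iff)
  have sums: "sum ?z X = sum zp (X \<inter> T) + sum zm (X - T)" if "X \<subseteq> S" for X
  proof -
    have "sum ?z X = (\<Sum>s\<in>X. if s \<in> T then zp s else zm s)"
      using that by (intro sum.cong) auto
    then show ?thesis
      using sum_split_if finite_subset[OF that fin] by simp
  qed
  have upper_z: "upper S p ?z"
    unfolding upper_def
  proof (intro allI impI)
    fix X assume X: "X \<subseteq> S"
    show "p X \<le> Fin (sum ?z X)"
    proof (cases "p X")
      case (Fin v)
      obtain c d where cd: "p (X \<inter> T) = Fin c" "p (X \<union> T) = Fin d" "v + sum y T \<le> c + d"
        using supermodular_Int_Un[OF sm X TS Fin pT] .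
      have "c \<le> sum zp (X \<inter> T)"
        using upper_Fin_le[OF zpB(1) _ cd(1)] by simp
      moreover have "contraction S p (S - T) (X - T) = Fin (d - sum y T)"
        by (simp add: pm cd(2))
      then have "d - sum y T \<le> sum zm (X - T)"
        using upper_Fin_le[OF zmB(1), of "X - T"] X by auto
      ultimately show ?thesis
        using sums[OF X] cd(3) Fin by simp
    next
      case Pinf
      then show ?thesis
        using sm X by (simp add: supermodular_on_def)
    qed simp
  qed
  have pS: "p S = Fin (sum ?z S)"
  proof -
    have "(S - T) \<union> T = S" "S \<inter> T = T"
      using TS by auto
    then show ?thesis
      using zmB(2) zpB(2) pT sums[of S] by (cases "p S") (auto simp: pm)
  qed
  have tight_p: "tight S p ?z Z" if "tight T p zp Z" for Z
  proof -
    have ZS: "Z \<subseteq> S" and eqs: "Z \<inter> T = Z" "Z - T = {}"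
      using that TS by (auto simp: tight_def)
    have "sum ?z Z = sum zp Z"
      using sums[OF ZS] unfolding eqs by simp
    then show ?thesis
      using that ZS by (simp add: tight_def)
  qed
  have tight_m: "tight S p ?z (T \<union> Z)" if "tight (S - T) (contraction S p (S - T)) zm Z" for Z
  proof -
    have "T \<union> Z \<subseteq> S" "(T \<union> Z) \<inter> T = T" "(T \<union> Z) - T = Z"
      using that TS by (auto simp: tight_def)
    moreover have "p (T \<union> Z) = Fin (sum zm Z + sum y T)"
      using that pm[of Z] by (cases "p (Z \<union> T)") (auto simp: tight_def Un_commute)
    ultimately show ?thesis
      using sums[of "T \<union> Z"] zpB(2) pT by (simp add: tight_def)
  qed
  \<comment> \<open>Threshold \<open>a + 1\<close>: the sum of the positive parts is zero for \<open>y\<close>, hence for \<open>zm\<close>.\<close>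
  have zm_le: "zm s \<le> a + 1" if s: "s \<in> S - T" for s
  proof -
    have "upper (S - T) (contraction S p (S - T)) y"
      unfolding upper_def
    proof (intro allI impI)
      fix X assume X: "X \<subseteq> S - T"
      then have "p (X \<union> T) \<le> Fin (sum y (X \<union> T))"
        using upperD[OF y, of "X \<union> T"] TS by auto
      moreover have "sum y (X \<union> T) = sum y X + sum y T"
        using X fin finT finite_subset by (intro sum.union_disjoint) auto
      ultimately show "contraction S p (S - T) X \<le> Fin (sum y X)"
        by (cases "p (X \<union> T)") (auto simp: pm)
    qed
    then have "positive_part_sum (S - T) (a + 1) zm \<le> positive_part_sum (S - T) (a + 1) y"
      using level_certified_least_majorized[OF _ zm] fin by simp
    also have "\<dots> = 0"
      unfolding positive_part_sum_def using high by (intro sum.neutral) auto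
    finally have "(\<Sum>s\<in>S - T. max (zm s - (a + 1)) 0) = 0"
      unfolding positive_part_sum_def by (intro order_antisym sum_nonneg) auto
    then have "max (zm s - (a + 1)) 0 = 0"
      using s fin by (subst (asm) sum_nonneg_eq_0_iff) auto
    then show ?thesis by simp
  qed
  \<comment> \<open>Threshold \<open>a\<close>: as \<open>y \<ge> a\<close> on \<open>T\<close>, the sum for \<open>y\<close> is \<open>y(T) - a|T| = zp(T) - a|T|\<close>,
    and the sum for \<open>zp\<close> exceeds this if some component of \<open>zp\<close> is below \<open>a\<close>.\<close>
  have zp_ge: "a \<le> zp s" if s: "s \<in> T" for s
  proof -
    have "upper T p y"
      using y TS by (auto simp: upper_def)
    then have "positive_part_sum T a zp \<le> positive_part_sum T a y"
      using level_certified_least_majorized[OF finT zp] by simp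
    also have "\<dots> = (\<Sum>s\<in>T. y s - a)"
      unfolding positive_part_sum_def using lower by (intro sum.cong) auto
    also have "\<dots> = (\<Sum>s\<in>T. zp s - a)"
      using pT zpB(2) by (simp add: sum_subtractf)
    finally have "(\<Sum>s\<in>T. max (zp s - a) 0 - (zp s - a)) \<le> 0"
      unfolding positive_part_sum_def sum_subtractf by simp
    then have "(\<Sum>s\<in>T. max (zp s - a) 0 - (zp s - a)) = 0"
      by (intro order_antisym sum_nonneg) auto
    then have "max (zp s - a) 0 - (zp s - a) = 0"
      using s finT by (subst (asm) sum_nonneg_eq_0_iff) auto
    then show ?thesis by simp
  qed
  have "\<exists>Z. tight S p ?z Z \<and> {s \<in> S. \<beta> < ?z s} \<subseteq> Z \<and> Z \<subseteq> {s \<in> S. \<beta> \<le> ?z s}" for \<beta>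
  proof (cases "\<beta> \<le> a")
    case True
    obtain Z where Z: "tight (S - T) (contraction S p (S - T)) zm Z"
        "{s \<in> S - T. \<beta> < zm s} \<subseteq> Z" "Z \<subseteq> {s \<in> S - T. \<beta> \<le> zm s}"
      using zm unfolding level_certified_def by blast
    have "{s \<in> S. \<beta> < ?z s} \<subseteq> T \<union> Z"
      using Z(2) by auto
    moreover have "T \<union> Z \<subseteq> {s \<in> S. \<beta> \<le> ?z s}"
      using Z(3) TS zp_ge True by force
    ultimately show ?thesis
      using tight_m[OF Z(1)] by blast
  next
    case False
    obtain Z where Z: "tight T p zp Z" "{s \<in> T. \<beta> < zp s} \<subseteq> Z" "Z \<subseteq> {s \<in> T. \<beta> \<le> zp s}"
      using zp unfolding level_certified_def by blast
    have "{s \<in> S. \<beta> < ?z s} \<subseteq> Z"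
    proof
      fix s assume "s \<in> {s \<in> S. \<beta> < ?z s}"
      then show "s \<in> Z"
        using Z(2) zm_le[of s] False by (cases "s \<in> T") auto
    qed
    moreover have "Z \<subseteq> {s \<in> S. \<beta> \<le> ?z s}"
      using Z(3) TS by auto
    ultimately show ?thesis
      using tight_p[OF Z(1)] by blast
  qed
  then show ?thesis
    using upper_z pS by (simp add: level_certified_def M_convex_set_iff)
qed

text \<open>This is why the recursion terminates. Since \<open>x\<close> has the right component sum but is not in the
  base-polyhedron, \<open>y\<close> must exceed \<open>x\<close> somewhere. A component that was raised lies in a tight set, and
  \<open>y(S) > x(S) = p(S)\<close> shows that \<open>S\<close> itself is not tight.\<close>

lemma proper_tight_set:
  assumes fin: "finite S" and sm: "supermodular_on S p"
    and x: "x \<in> S \<rightarrow>\<^sub>E UNIV" "p S = Fin (sum x S)" "x \<notin> M_convex_set S p"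
    and y: "minimal_above S p x y"
  defines "T \<equiv> {s. \<exists>X. tight S p y X \<and> s \<in> X}"
  shows "tight S p y T" "T \<noteq> {}" "T \<subset> S" "\<forall>s\<in>S - T. y s = x s"
proof -
  have y': "y \<in> S \<rightarrow>\<^sub>E UNIV" "upper S p y" "\<forall>s\<in>S. x s \<le> y s"
      "\<forall>s\<in>S. y s = x s \<or> (\<exists>X. tight S p y X \<and> s \<in> X)"
    using y by (auto simp: minimal_above_iff[OF fin])
  show T: "tight S p y T"
    unfolding T_def by (rule union_of_tight_sets[OF fin sm y'(2)])
  show yx: "\<forall>s\<in>S - T. y s = x s"
    using y'(4) by (auto simp: T_def)
  have "y \<noteq> x"
    using x y'(2) by (auto simp: M_convex_set_iff)
  then obtain s where s: "s \<in> S" "x s < y s"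
    using x(1) y'(1,3) by (metis PiE_ext order_le_less)
  then show "T \<noteq> {}"
    using yx by force
  have "sum x S < sum y S"
    using s y'(3) fin by (intro sum_strict_mono_ex1) auto
  then show "T \<subset> S"
    using T x(2) by (auto simp: tight_def)
qed

proposition groenevelt_level_certified:
  fixes S :: "'a set"
  assumes pick: "valid_choice pick" and miny: "finds_minimal miny"
    and "finite S" "S \<noteq> {}" "supermodular_on S p"
  shows "\<exists>z. groenevelt pick miny S p = Some z \<and> level_certified S p z"
  using assms(3-5)
proof (induction "card S" arbitrary: S p rule: less_induct)
  case less
  note fin = less.prems(1) and sm = less.prems(3)
  define x where "x = start_vector pick S (fin_part (p S))"
  define y where "y = miny S p x"
  define T where "T = {s. \<exists>X. tight S p y X \<and> s \<in> X}"
  obtain v where v: "p S = Fin v"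
    using supermodular_ground_set[OF sm] by blast
  obtain a where x: "x \<in> S \<rightarrow>\<^sub>E UNIV" "sum x S = v" "\<forall>s\<in>S. a \<le> x s \<and> x s \<le> a + 1"
    using start_vector_properties[OF pick fin less.prems(2), of v] v
    unfolding x_def fin_part_def by fastforce
  show ?case
  proof (cases "x \<in> M_convex_set S p")
    case True
    then show ?thesis
      using level_certified_near_uniform[OF fin sm True x(3)]
      by (subst groenevelt.simps) (simp add: x_def)
  next
    case False
    have y: "minimal_above S p x y"
      using miny fin less.prems(2) sm x(1) by (simp add: finds_minimal_def y_def)
    then have y_upper: "upper S p y" "\<forall>s\<in>S. x s \<le> y s"
      by (auto simp: minimal_above_iff[OF fin])
    note T = proper_tight_set[OF fin sm x(1) _ False y, folded T_def, unfolded v x(2), OF refl]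
    have T_greatest: "(GREATEST X. X \<subseteq> S \<and> Fin (\<Sum>s\<in>X. y s) = p X) = T"
      unfolding T_def by (rule largest_tight_set[OF fin sm y_upper(1)])
    have finT: "finite T" "finite (S - T)"
      using T(3) fin finite_subset by auto
    have pT: "p T = Fin (sum y T)" and TS: "T \<subseteq> S"
      using T(1) by (auto simp: tight_def)
    have "card T < card S" "card (S - T) < card S" "S - T \<noteq> {}"
      using T(2,3) fin by (auto intro!: psubset_card_mono)
    then obtain zp zm where zp: "groenevelt pick miny T p = Some zp" "level_certified T p zp"
      and zm: "groenevelt pick miny (S - T) (contraction S p (S - T)) = Some zm"
        "level_certified (S - T) (contraction S p (S - T)) zm"
      using less.hyps[OF _ finT(1) T(2) supermodular_restriction[OF sm TS pT]]
        less.hyps[OF _ finT(2) _ supermodular_contraction[OF sm TS pT]] by blast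
    have "groenevelt pick miny S p = Some (\<lambda>s\<in>S. if s \<in> T then zp s else zm s)"
      using False zp(1) zm(1) T_greatest
      by (subst groenevelt.simps) (simp add: Let_def flip: x_def y_def)
    moreover have "\<forall>s\<in>T. a \<le> y s" "\<forall>s\<in>S - T. y s \<le> a + 1"
      using x(3) y_upper(2) T(4) TS by force+
    then have "level_certified S p (\<lambda>s\<in>S. if s \<in> T then zp s else zm s)"
      using level_certified_gluing[OF fin sm y_upper(1) T(1)] zp(2) zm(2) by blast
    ultimately show ?thesis by blast
  qed
qed

section \<open>The subprocedures\<close>

text \<open>The polynomial is made explicit because the time bound of the algorithm is built from it.\<close>

definition sfm_bound :: "'a sfm_routine \<Rightarrow> nat poly \<Rightarrow> bool" where
  "sfm_bound sfm \<sigma> \<longleftrightarrow>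
     (\<forall>S f. finite S \<and> S \<noteq> {} \<and> submodular_on S (\<lambda>X. result (f X)) \<longrightarrow>
        is_arg_min (\<lambda>X. result (f X)) (\<lambda>X. X \<subseteq> S) (result (sfm S f)) \<and>
        (\<forall>c. (\<forall>X \<subseteq> S. ops (f X) \<le> c) \<longrightarrow> ops (sfm S f) \<le> poly \<sigma> (card S) * (c + 1)))"

lemma submodular_excess:
  assumes "finite S" "supermodular_on S (\<lambda>X. result (q X))"
  shows "submodular_on S (\<lambda>X. result (excess q y X))"
  using supermodular_excess[OF assms] by (simp add: submodular_on_def excess_def)

text \<open>The minimum of the excess is at most its value 0 at the empty set and is not \<open>-\<infinity>\<close>, so the default
  value of \<open>fin_part\<close> is never taken. The two statements determine the deficit uniquely.\<close>

lemma deficit_attained_and_bound: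
  fixes y :: "'a \<Rightarrow> int"
  assumes sfm: "sfm_bound sfm \<sigma>" and "finite S" "S \<noteq> {}"
    and sm: "supermodular_on S (\<lambda>X. result (q X))"
  defines "d \<equiv> result (deficit sfm S q y)"
  shows "\<exists>X\<subseteq>S. result (q X) = Fin (sum y X + d)"
    and "\<And>X. X \<subseteq> S \<Longrightarrow> result (q X) \<le> Fin (sum y X + d)"
proof -
  define Z where "Z = result (sfm S (excess q y))"
  have "is_arg_min (\<lambda>X. result (excess q y X)) (\<lambda>X. X \<subseteq> S) Z"
    using sfm submodular_excess[OF assms(2) sm] assms(2,3) by (simp add: sfm_bound_def Z_def)
  then have Z: "Z \<subseteq> S" "\<And>X. X \<subseteq> S \<Longrightarrow> Fin (sum y Z) - result (q Z) \<le> Fin (sum y X) - result (q X)"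
    by (auto simp: is_arg_min_linorder excess_def)
  have fin: "result (q X) \<noteq> \<infinity>" if "X \<subseteq> S" for X
    using sm that by (simp add: supermodular_on_def)
  have "Fin (sum y Z) - result (q Z) \<le> Fin 0"
    using Z(2)[of "{}"] supermodular_empty[OF sm] by simp
  then obtain v where v: "result (q Z) = Fin v"
    using fin[OF Z(1)] by (cases "result (q Z)") auto
  have "result (excess q y Z) = Fin (sum y Z - v)"
    by (simp add: excess_def v)
  then have d: "d = v - sum y Z"
    by (simp add: d_def deficit_def Let_def fin_part_def flip: Z_def)
  then show "\<exists>X\<subseteq>S. result (q X) = Fin (sum y X + d)"
    using Z(1) v by auto
  show "result (q X) \<le> Fin (sum y X + d)" if "X \<subseteq> S" for X
    using Z(2)[OF that] fin[OF that] v d by (cases "result (q X)") auto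
qed

lemma deficit_nonneg:
  assumes "sfm_bound sfm \<sigma>" "finite S" "S \<noteq> {}" "supermodular_on S (\<lambda>X. result (q X))"
  shows "0 \<le> result (deficit sfm S q y)"
  using deficit_attained_and_bound(2)[OF assms, of "{}" y] supermodular_empty[OF assms(4)] by simp

lemma deficit_le_0_iff:
  assumes "sfm_bound sfm \<sigma>" "finite S" "S \<noteq> {}" "supermodular_on S (\<lambda>X. result (q X))"
  shows "result (deficit sfm S q y) \<le> 0 \<longleftrightarrow> upper S (\<lambda>X. result (q X)) y"
proof
  assume d: "result (deficit sfm S q y) \<le> 0"
  show "upper S (\<lambda>X. result (q X)) y"
    unfolding upper_def
  proof (intro allI impI)
    fix X assume "X \<subseteq> S"
    then have "result (q X) \<le> Fin (sum y X + result (deficit sfm S q y))"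
      by (rule deficit_attained_and_bound(2)[OF assms])
    also have "\<dots> \<le> Fin (sum y X)"
      using d by simp
    finally show "result (q X) \<le> Fin (sum y X)" .
  qed
next
  assume y: "upper S (\<lambda>X. result (q X)) y"
  obtain X where "X \<subseteq> S" "result (q X) = Fin (sum y X + result (deficit sfm S q y))"
    using deficit_attained_and_bound(1)[OF assms] by blast
  then have "sum y X + result (deficit sfm S q y) \<le> sum y X"
    by (rule upper_Fin_le[OF y])
  then show "result (deficit sfm S q y) \<le> 0"
    by simp
qed

text \<open>The subroutine may choose among several minimizing sets depending on the costs that the oracle
  reports, but the minimum value is unique.\<close>

lemma deficit_only_depends_on_values:
  assumes sfm: "sfm_bound sfm \<sigma>" and "finite S" "S \<noteq> {}"
    and sm: "supermodular_on S (\<lambda>X. result (q X))" "\<And>X. result (q' X) = result (q X)"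
  shows "result (deficit sfm S q' y) = result (deficit sfm S q y)"
proof -
  have sm': "supermodular_on S (\<lambda>X. result (q' X))"
    using sm by simp
  note D = deficit_attained_and_bound[OF sfm assms(2,3) sm(1)]
  note D' = deficit_attained_and_bound[OF sfm assms(2,3) sm', unfolded sm(2)]
  obtain X where X: "X \<subseteq> S" "result (q X) = Fin (sum y X + result (deficit sfm S q y))"
    using D(1) by blast
  obtain X' where X': "X' \<subseteq> S" "result (q X') = Fin (sum y X' + result (deficit sfm S q' y))"
    using D'(1) by blast
  show ?thesis
    using D(2)[OF X'(1), of y] D'(2)[OF X(1), of y] X(2) X'(2) by simp
qed

text \<open>The deficit \<open>d\<close> of \<open>y(s := x s)\<close> repairs all violated constraints at once, since \<open>y\<close> itself violates
  none and so only sets through \<open>s\<close> can be violated. A set that attains a positive \<open>d\<close> becomes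
  tight and also shows that \<open>x s + d\<close> does not exceed \<open>y s\<close>.\<close>

lemma lower_component:
  assumes sfm: "sfm_bound sfm \<sigma>" and fin: "finite S" and S: "S \<noteq> {}"
    and sm: "supermodular_on S (\<lambda>X. result (q X))"
    and y: "upper S (\<lambda>X. result (q X)) y" and s: "s \<in> S" "x s \<le> y s"
  defines "d \<equiv> result (deficit sfm S q (y(s := x s)))"
  defines "z \<equiv> y(s := x s + d)"
  shows "upper S (\<lambda>X. result (q X)) z" "x s \<le> z s" "z s \<le> y s"
    and "z s = x s \<or> (\<exists>X. tight S (\<lambda>X. result (q X)) z X \<and> s \<in> X)"
proof -
  note D = deficit_attained_and_bound[OF sfm fin S sm, where y = "y(s := x s)", folded d_def]
  have sum_z: "sum z X = sum y X + (if s \<in> X then x s + d - y s else 0)"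
    and sum_d: "sum (y(s := x s)) X = sum y X + (if s \<in> X then x s - y s else 0)" if "X \<subseteq> S" for X
    unfolding z_def using finite_subset[OF that fin] by (rule sum_fun_upd)+
  have d: "0 \<le> d"
    unfolding d_def by (rule deficit_nonneg[OF sfm fin S sm])
  then show "x s \<le> z s"
    by (simp add: z_def)
  obtain X where X: "X \<subseteq> S" "result (q X) = Fin (sum (y(s := x s)) X + d)"
    using D(1) by blast
  have X_le: "sum (y(s := x s)) X + d \<le> sum y X"
    using upper_Fin_le[OF y X] .
  show "z s \<le> y s"
    using X_le s(2) d unfolding sum_d[OF X(1)] by (auto simp: z_def split: if_splits)
  show "upper S (\<lambda>X. result (q X)) z"
    unfolding upper_def
  proof (intro allI impI)
    fix Y assume Y: "Y \<subseteq> S"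
    show "result (q Y) \<le> Fin (sum z Y)"
      using D(2)[OF Y] upperD[OF y Y] unfolding sum_z[OF Y] sum_d[OF Y]
      by (cases "s \<in> Y") (auto simp: algebra_simps)
  qed
  show "z s = x s \<or> (\<exists>X. tight S (\<lambda>X. result (q X)) z X \<and> s \<in> X)"
  proof (cases "d = 0")
    case False
    then have "s \<in> X"
      using X_le d unfolding sum_d[OF X(1)] by (auto split: if_splits)
    then have "tight S (\<lambda>X. result (q X)) z X"
      using X unfolding tight_def sum_z[OF X(1)] sum_d[OF X(1)] by simp
    then show ?thesis
      using \<open>s \<in> X\<close> by blast
  qed (simp add: z_def)
qed

text \<open>Hence a component that is blocked by a tight set stays blocked while others are lowered, so one pass
  over all components suffices.\<close>

lemma tight_anti_mono:
  assumes "upper S p z" "\<And>s. s \<in> S \<Longrightarrow> z s \<le> y s" "tight S p y X"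
  shows "tight S p z X"
proof -
  have X: "X \<subseteq> S" "p X = Fin (sum y X)"
    using assms(3) by (auto simp: tight_def)
  have "sum z X \<le> sum y X"
    using X(1) assms(2) by (intro sum_mono) auto
  then show ?thesis
    using X upper_Fin_le[OF assms(1) X] by (simp add: tight_def)
qed

lemma lower_all_lowers_maximally:
  assumes sfm: "sfm_bound sfm \<sigma>" and fin: "finite S" and S: "S \<noteq> {}"
    and sm: "supermodular_on S (\<lambda>X. result (q X))"
    and "y \<in> S \<rightarrow>\<^sub>E UNIV" "upper S (\<lambda>X. result (q X)) y" "\<forall>s\<in>S. x s \<le> y s" "set ss \<subseteq> S"
  defines "z \<equiv> result (lower_all sfm S q x ss y)"
  shows "z \<in> S \<rightarrow>\<^sub>E UNIV \<and> upper S (\<lambda>X. result (q X)) z \<and> (\<forall>s\<in>S. x s \<le> z s \<and> z s \<le> y s) \<and>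
    (\<forall>s\<in>set ss. z s = x s \<or> (\<exists>X. tight S (\<lambda>X. result (q X)) z X \<and> s \<in> X))"
  using assms(5-8) unfolding z_def
proof (induction ss arbitrary: y)
  case Nil
  then show ?case by simp
next
  case (Cons s ss)
  define y1 where "y1 = y(s := x s + result (deficit sfm S q (y(s := x s))))"
  have s: "s \<in> S" "x s \<le> y s"
    using Cons.prems(3,4) by auto
  note y1 = lower_component[OF sfm fin S sm Cons.prems(2) s(1), of x, OF s(2), folded y1_def]
  have ext: "y1 \<in> S \<rightarrow>\<^sub>E UNIV"
    using Cons.prems(1) s(1) by (auto simp: y1_def PiE_def extensional_def)
  have le: "\<forall>t\<in>S. x t \<le> y1 t \<and> y1 t \<le> y t"
    using Cons.prems(3) y1(2,3) by (auto simp: y1_def)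
  define z where "z = result (lower_all sfm S q x ss y1)"
  have eq: "result (lower_all sfm S q x (s # ss) y) = z"
    by (simp add: Let_def z_def y1_def)
  have z: "z \<in> S \<rightarrow>\<^sub>E UNIV" "upper S (\<lambda>X. result (q X)) z" "\<forall>s\<in>S. x s \<le> z s \<and> z s \<le> y1 s"
      "\<forall>s\<in>set ss. z s = x s \<or> (\<exists>X. tight S (\<lambda>X. result (q X)) z X \<and> s \<in> X)"
    using Cons.IH[OF ext y1(1)] le Cons.prems(4) by (auto simp: z_def)
  have "z s = x s \<or> (\<exists>X. tight S (\<lambda>X. result (q X)) z X \<and> s \<in> X)"
    using y1(4)
  proof
    assume "y1 s = x s"
    then show ?thesis
      using z(3) s(1) by force
  next
    assume "\<exists>X. tight S (\<lambda>X. result (q X)) y1 X \<and> s \<in> X"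
    then show ?thesis
      using tight_anti_mono[OF z(2), of y1] z(3) by blast
  qed
  moreover have "\<forall>t\<in>S. x t \<le> z t \<and> z t \<le> y t"
    using z(3) le by force
  ultimately show ?case
    unfolding eq using z by simp
qed

lemma greedy_minimal_correct:
  assumes sfm: "sfm_bound sfm \<sigma>" and fin: "finite S" and S: "S \<noteq> {}"
    and sm: "supermodular_on S (\<lambda>X. result (q X))"
    and ss: "set ss = S"
  shows "minimal_above S (\<lambda>X. result (q X)) x (result (greedy_minimal sfm ss S q x))"
proof -
  define d where "d = result (deficit sfm S q x)"
  define y where "y = (\<lambda>s\<in>S. x s + d)"
  have d: "0 \<le> d"
    unfolding d_def by (rule deficit_nonneg[OF sfm fin S sm])
  have "upper S (\<lambda>X. result (q X)) y"
    unfolding upper_def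
  proof (intro allI impI)
    fix X assume X: "X \<subseteq> S"
    show "result (q X) \<le> Fin (sum y X)"
    proof (cases "X = {}")
      case True
      then show ?thesis
        using supermodular_empty[OF sm] by simp
    next
      case False
      then have "1 \<le> card X"
        using X fin finite_subset by (fastforce simp: Suc_le_eq card_gt_0_iff)
      then have "d \<le> int (card X) * d"
        using d by (simp add: mult_le_cancel_right1)
      moreover have "sum y X = sum x X + int (card X) * d"
        using X by (simp add: y_def sum.distrib subset_iff)
      ultimately show ?thesis
        using deficit_attained_and_bound(2)[OF sfm fin S sm X, of x, folded d_def]
        by (cases "result (q X)") auto
    qed
  qed
  moreover have "y \<in> S \<rightarrow>\<^sub>E UNIV" "\<forall>s\<in>S. x s \<le> y s"
    using d by (auto simp: y_def)
  ultimately show ?thesis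
    unfolding minimal_above_iff[OF fin]
    using lower_all_lowers_maximally[OF sfm fin S sm, of y x ss] ss
    by (simp add: greedy_minimal_def Let_def y_def d_def)
qed

lemma greedy_minimal_only_depends_on_values:
  assumes sfm: "sfm_bound sfm \<sigma>" and "finite S" "S \<noteq> {}"
    and sm: "supermodular_on S (\<lambda>X. result (q X))" "\<And>X. result (q' X) = result (q X)"
  shows "result (greedy_minimal sfm ss S q' x) = result (greedy_minimal sfm ss S q x)"
proof -
  note eq = deficit_only_depends_on_values[OF assms]
  have "result (lower_all sfm S q' x ss y) = result (lower_all sfm S q x ss y)" for y
    by (induction ss arbitrary: y) (simp_all add: Let_def eq)
  then show ?thesis
    by (simp add: greedy_minimal_def Let_def eq)
qed

lemma tight_elements_correct:
  assumes sfm: "sfm_bound sfm \<sigma>" and fin: "finite S" and S: "S \<noteq> {}"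
    and sm: "supermodular_on S (\<lambda>X. result (q X))" and y: "upper S (\<lambda>X. result (q X)) y"
  shows "result (tight_elements sfm S q y) = {s. \<exists>X. tight S (\<lambda>X. result (q X)) y X \<and> s \<in> X}"
proof -
  have "0 < result (deficit sfm S q (y(s := y s - 1))) \<longleftrightarrow>
      (\<exists>X. tight S (\<lambda>X. result (q X)) y X \<and> s \<in> X)" if s: "s \<in> S" for s
  proof -
    define d where "d = result (deficit sfm S q (y(s := y s - 1)))"
    note D = deficit_attained_and_bound[OF sfm fin S sm, where y = "y(s := y s - 1)", folded d_def]
    have sum_s: "sum (y(s := y s - 1)) X = sum y X - (if s \<in> X then 1 else 0)" if "X \<subseteq> S" for X
      using finite_subset[OF that fin] by (simp add: sum_fun_upd del: fun_upd_apply)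
    have "\<exists>X. tight S (\<lambda>X. result (q X)) y X \<and> s \<in> X" if d: "0 < d"
    proof -
      obtain X where X: "X \<subseteq> S" "result (q X) = Fin (sum (y(s := y s - 1)) X + d)"
        using D(1) by blast
      have "sum (y(s := y s - 1)) X + d \<le> sum y X"
        using upper_Fin_le[OF y X] .
      then have "s \<in> X" "sum (y(s := y s - 1)) X + d = sum y X"
        using d unfolding sum_s[OF X(1)] by (auto split: if_splits)
      then show ?thesis
        using X by (auto simp: tight_def)
    qed
    moreover have "0 < d" if "tight S (\<lambda>X. result (q X)) y X" "s \<in> X" for X
      using D(2)[of X] that sum_s[of X] by (simp add: tight_def del: fun_upd_apply)
    ultimately show ?thesis
      unfolding d_def by blast
  qed
  then show ?thesis
    by (auto simp: tight_elements_def tight_def)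
qed

section \<open>Counting operations\<close>

lemma poly_nat_mono:
  fixes f :: "nat poly"
  assumes "m \<le> n"
  shows "poly f m \<le> poly f n"
  by (induction f) (auto intro!: add_mono mult_mono assms)

definition deficit_poly :: "nat poly \<Rightarrow> nat poly" where
  "deficit_poly \<sigma> = \<sigma> * [:2, 1:] + [:3, 1:]"

text \<open>With \<open>N\<close> bounding both the size of the ground set and the query time, and \<open>D\<close> the cost of a deficit,
  one call performs at most \<open>2 + 2N\<close> deficit computations: one for the test of the start vector, one to
  reach the upper polyhedron, \<open>N\<close> to lower the components and \<open>N\<close> to find the tight elements. The
  linear part collects everything else.\<close>

definition call_poly :: "nat poly \<Rightarrow> nat poly" where
  "call_poly \<sigma> = deficit_poly \<sigma> * [:2, 2:] + [:5, 9:]"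

text \<open>The hypothesis bounds query time plus size of the ground set, since this is the quantity that
  does not grow along the recursion.\<close>

lemma deficit_ops:
  assumes sfm: "sfm_bound sfm \<sigma>" and fin: "finite S" and S: "S \<noteq> {}"
    and sm: "supermodular_on S (\<lambda>X. result (q X))"
    and c: "\<forall>X\<subseteq>S. ops (q X) \<le> c" and N: "c + card S \<le> N"
  shows "ops (deficit sfm S q y) \<le> poly (deficit_poly \<sigma>) N"
proof -
  define Z where "Z = sfm S (excess q y)"
  have e: "ops (excess q y X) \<le> N + 1" if "X \<subseteq> S" for X
    using c[rule_format, OF that] card_mono[OF fin that] N by (simp add: excess_def)
  have "is_arg_min (\<lambda>X. result (excess q y X)) (\<lambda>X. X \<subseteq> S) (result Z)"
    and "\<forall>c. (\<forall>X\<subseteq>S. ops (excess q y X) \<le> c) \<longrightarrow> ops Z \<le> poly \<sigma> (card S) * (c + 1)"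
    using sfm[unfolded sfm_bound_def, rule_format, of S "excess q y"]
      submodular_excess[OF fin sm] fin S
    unfolding Z_def by blast+
  then have "result Z \<subseteq> S" "ops Z \<le> poly \<sigma> (card S) * (N + 1 + 1)"
    using e by (blast dest: is_arg_min_linorder[THEN iffD1])+
  moreover have "poly \<sigma> (card S) * (N + 1 + 1) \<le> poly \<sigma> N * (N + 2)"
    using poly_nat_mono[of "card S" N \<sigma>] N by (intro mult_mono) auto
  ultimately show ?thesis
    using e[of "result Z"] by (simp add: deficit_def Let_def deficit_poly_def algebra_simps flip: Z_def)
qed

lemma lower_all_ops:
  assumes "\<And>y. ops (deficit sfm S q y) \<le> D"
  shows "ops (lower_all sfm S q x ss y) \<le> length ss * (D + 1)"
proof (induction ss arbitrary: y)
  case (Cons s ss)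
  show ?case
    using add_mono[OF assms[of "y(s := x s)"] Cons.IH[of "y(s := x s + result (deficit sfm S q (y(s := x s))))"]]
    by (simp add: Let_def del: fun_upd_apply)
qed simp

lemma greedy_minimal_ops:
  assumes "\<And>y. ops (deficit sfm S q y) \<le> D"
  shows "ops (greedy_minimal sfm ss S q x) \<le> D + card S + length ss * (D + 1)"
  using assms lower_all_ops[OF assms] by (simp add: greedy_minimal_def Let_def add_mono)

lemma tight_elements_ops:
  assumes "\<And>y. ops (deficit sfm S q y) \<le> D"
  shows "ops (tight_elements sfm S q y) \<le> card S * (D + 2)"
  using sum_bounded_above[of S "\<lambda>s. ops (deficit sfm S q (y(s := y s - 1))) + 2" "D + 2"] assms
  by (simp add: tight_elements_def)

section \<open>The implementation\<close>

lemma greedy_finds_minimal: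
  assumes "sfm_bound sfm \<sigma>" "valid_enum enum"
  shows "finds_minimal (\<lambda>S p x. result (greedy_minimal sfm (enum S) S (eval_oracle p) x))"
  unfolding finds_minimal_def
proof (intro allI impI, elim conjE)
  fix S :: "'a set" and p x
  assume S: "finite S" "S \<noteq> {}" "supermodular_on S p"
  have "(\<lambda>X. result (eval_oracle p X)) = p"
    by (simp add: eval_oracle_def)
  then show "minimal_above S p x (result (greedy_minimal sfm (enum S) S (eval_oracle p) x))"
    using greedy_minimal_correct[OF assms(1) S(1,2), of "eval_oracle p" "enum S" x] S assms(2)
    by (simp add: valid_enum_def)
qed

text \<open>With \<open>K\<close> bounding the work in one call, the bound \<open>(2|S| - 1) K\<close> is stated as
  \<open>t + K \<le> 2|S| K\<close>. In this form the bounds of the two recursive calls add up to that of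
  their parent: \<open>(tp + K) + (tm + K) \<le> 2|T| K + 2|S - T| K\<close>, where one of the two \<open>K\<close> on
  the left pays for the call itself. The number \<open>N\<close> is common to the whole recursion.\<close>

proposition groenevelt_impl_simulates:
  fixes S :: "'a set" and q :: "'a set_oracle"
  assumes sfm: "sfm_bound sfm \<sigma>" and pick: "valid_choice pick" and enum: "valid_enum enum"
    and "finite S" "S \<noteq> {}" "supermodular_on S (\<lambda>X. result (q X))"
    and "\<forall>X\<subseteq>S. ops (q X) \<le> c" "c + card S \<le> N"
  defines "miny \<equiv> \<lambda>S p x. result (greedy_minimal sfm (enum S) S (eval_oracle p) x)"
  defines "K \<equiv> poly (call_poly \<sigma>) N"
  shows "\<exists>z t. groenevelt_impl sfm pick enum S q = Some (z, t) \<and>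
    groenevelt pick miny S (\<lambda>X. result (q X)) = Some z \<and> t + K \<le> 2 * card S * K"
  using assms(4-8)
proof (induction "card S" arbitrary: S q c rule: less_induct)
  case less
  note fin = less.prems(1) and S = less.prems(2) and sm = less.prems(3)
  define p where "p = (\<lambda>X. result (q X))"
  define x where "x = start_vector pick S (fin_part (p S))"
  define d where "d = deficit sfm S q x"
  define y where "y = greedy_minimal sfm (enum S) S q x"
  define E where "E = tight_elements sfm S q (result y)"
  define T where "T = result E"
  define D where "D = poly (deficit_poly \<sigma>) N"
  have q: "\<And>X. result (q X) = p X"
    by (simp add: p_def)
  have sm_p: "supermodular_on S p"
    using sm by (simp add: p_def)
  have card_S: "1 \<le> card S" "card S \<le> N" "c \<le> N"
    using fin S less.prems(5) by (auto simp: Suc_le_eq card_gt_0_iff)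
  have D: "ops (deficit sfm S q y) \<le> D" for y
    unfolding D_def by (rule deficit_ops[OF sfm fin S sm less.prems(4,5)])
  have K: "K = D * (2 + 2 * N) + 5 + 9 * N"
    by (simp add: K_def call_poly_def D_def algebra_simps)
  obtain v where v: "p S = Fin v"
    using supermodular_ground_set[OF sm_p] by blast
  have x: "x \<in> S \<rightarrow>\<^sub>E UNIV" "sum x S = v"
    using start_vector_properties[OF pick fin S, of v] v by (auto simp: x_def fin_part_def)
  have base_iff: "x \<in> M_convex_set S p \<longleftrightarrow> result d \<le> 0"
    unfolding d_def deficit_le_0_iff[OF sfm fin S sm] M_convex_set_iff using x v by (simp add: p_def)
  define t where "t = ops (q S) + card S + 4 + card S + ops d + 1"
  have t: "t \<le> D + 5 + 3 * N"
    using less.prems(4)[rule_format, OF order_refl] D[of x] card_S by (simp add: t_def d_def)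
  show ?case
  proof (cases "result d \<le> 0")
    case True
    have "groenevelt_impl sfm pick enum S q = Some (x, t)"
      using True by (subst groenevelt_impl.simps) (simp add: Let_def q t_def flip: x_def d_def)
    moreover have "groenevelt pick miny S p = Some x"
      using True base_iff by (subst groenevelt.simps) (simp add: Let_def flip: x_def)
    moreover have "t \<le> K"
      using t unfolding K by simp
    then have "t + K \<le> 2 * card S * K"
      using mult_right_mono[of 2 "2 * card S" K] card_S(1) by linarith
    ultimately show ?thesis
      unfolding p_def by blast
  next
    case False
    have set_enum: "set (enum S) = S" "length (enum S) = card S"
      using enum fin distinct_card[of "enum S"] by (auto simp: valid_enum_def)
    have y_eq: "miny S p x = result y"
      unfolding miny_def y_def
      by (rule greedy_minimal_only_depends_on_values[OF sfm fin S sm]) (simp add: eval_oracle_def q)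
    have y: "minimal_above S p x (result y)"
      unfolding y_def p_def by (rule greedy_minimal_correct[OF sfm fin S sm set_enum(1)])
    then have y_upper: "upper S p (result y)"
      by (simp add: minimal_above_iff[OF fin])
    have T_eq: "T = {s. \<exists>X. tight S p (result y) X \<and> s \<in> X}"
      using tight_elements_correct[OF sfm fin S sm, of "result y"] y_upper
      by (simp add: T_def E_def p_def)
    have not_base: "x \<notin> M_convex_set S p"
      using False base_iff by simp
    note T = proper_tight_set[OF fin sm_p x(1) _ not_base y, folded T_eq, unfolded v x(2), OF refl]
    have T_greatest: "(GREATEST X. X \<subseteq> S \<and> Fin (\<Sum>s\<in>X. result y s) = p X) = T"
      unfolding T_eq by (rule largest_tight_set[OF fin sm_p y_upper])
    have finT: "finite T" "finite (S - T)" and TS: "T \<subseteq> S" and compl: "S - (S - T) = T"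
      using T(3) fin finite_subset by auto
    have pT: "p T = Fin (sum (result y) T)"
      using T(1) by (simp add: tight_def)
    have cards: "card T < card S" "card (S - T) < card S" "S - T \<noteq> {}"
      using T(2,3) fin by (auto intro!: psubset_card_mono)
    have card_split: "card S = card T + card (S - T)"
      using card_mono[OF fin TS] by (simp add: card_Diff_subset finT TS)
    define r where "r = contraction_oracle q T (p T)"
    have r: "(\<lambda>X. result (r X)) = contraction S p (S - T)"
      by (simp add: r_def contraction_oracle_def contraction_def compl q)
    have "\<forall>X\<subseteq>T. ops (q X) \<le> c" "c + card T \<le> N"
      using less.prems(4,5) TS cards(1) by auto
    then obtain zp tp where zp: "groenevelt_impl sfm pick enum T q = Some (zp, tp)"
        "groenevelt pick miny T p = Some zp" "tp + K \<le> 2 * card T * K"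
      using less.hyps[OF cards(1) finT(1) T(2), of q c] supermodular_restriction[OF sm_p TS pT]
      unfolding q by blast
    have "ops (r X) \<le> c + 1" if "X \<subseteq> S - T" for X
    proof -
      have "X \<union> T \<subseteq> S"
        using that TS by auto
      then show ?thesis
        using less.prems(4) by (simp add: r_def contraction_oracle_def)
    qed
    moreover have "c + 1 + card (S - T) \<le> N"
      using less.prems(5) cards(2) by simp
    ultimately obtain zm tm where zm: "groenevelt_impl sfm pick enum (S - T) r = Some (zm, tm)"
        "groenevelt pick miny (S - T) (contraction S p (S - T)) = Some zm"
        "tm + K \<le> 2 * card (S - T) * K"
      using less.hyps[OF cards(2) finT(2) cards(3), of r "c + 1"]
        supermodular_contraction[OF sm_p TS pT]
      unfolding r by blast
    define z where "z = (\<lambda>s\<in>S. if s \<in> T then zp s else zm s)"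
    \<comment> \<open>The form in which the recursive results occur in the unfolded program.\<close>
    have z_eq: "z = (\<lambda>s\<in>S. if s \<in> T then result (zp, tp) s else result (zm, tm) s)"
      by (simp only: z_def fst_conv)
    define own where "own = t + ops y + ops E + ops (q T) + card S"
    have impl: "groenevelt_impl sfm pick enum S q = Some (z, own + tp + tm)"
      using False zp(1) zm(1)
      by (subst groenevelt_impl.simps)
        (simp add: Let_def q z_eq own_def t_def
          flip: x_def d_def y_def E_def T_def r_def)
    have abstract: "groenevelt pick miny S p = Some z"
      using not_base zp(2) zm(2) T_greatest y_eq
      by (subst groenevelt.simps) (simp add: Let_def z_def flip: x_def)
    have "ops y \<le> D + card S + card S * (D + 1)" "ops E \<le> card S * (D + 2)"
      using greedy_minimal_ops[of sfm S q D "enum S" x, OF D] tight_elements_ops[of sfm S q D, OF D]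
      by (auto simp: y_def E_def set_enum(2))
    moreover have "card S * (D + 1) \<le> N * (D + 1)" "card S * (D + 2) \<le> N * (D + 2)"
      using card_S(2) by (intro mult_right_mono; simp)+
    moreover have "ops (q T) \<le> N"
      using less.prems(4)[rule_format, OF TS] card_S(3) by simp
    ultimately have "own \<le> (D + 5 + 3 * N) + (D + N + N * (D + 1)) + N * (D + 2) + N + N"
      using t card_S(2) unfolding own_def by linarith
    also have "\<dots> = K"
      unfolding K by (simp add: algebra_simps)
    finally have "own \<le> K" .
    then have "own + tp + tm + K \<le> (tp + K) + (tm + K)"
      by simp
    also have "\<dots> \<le> 2 * card S * K"
      using add_mono[OF zp(3) zm(3)] card_split by (simp add: algebra_simps)
    finally show ?thesis
      using impl abstract unfolding p_def by blast
  qed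
qed

theorem proposition5p3:
  fixes sfm :: "'a sfm_routine"
  assumes "strongly_polynomial_sfm sfm"
  shows "(\<forall>pick miny (S :: 'a set) (p :: 'a set \<Rightarrow> int extended).
            valid_choice pick \<and> finds_minimal miny \<and>
            finite S \<and> S \<noteq> {} \<and> supermodular_on S p \<longrightarrow>
            (\<exists>z. groenevelt pick miny S p = Some z \<and>
                 is_arg_min (square_sum S) (\<lambda>x. x \<in> M_convex_set S p) z \<and>
                 decreasingly_minimal S (M_convex_set S p) z)) \<and>
         (\<exists>\<pi> :: nat poly. \<forall>pick enum (S :: 'a set) (p :: 'a set \<Rightarrow> int extended).
            valid_choice pick \<and> valid_enum enum \<and>
            finite S \<and> S \<noteq> {} \<and> supermodular_on S p \<longrightarrow>
            (let miny = (\<lambda>S p x. result (greedy_minimal sfm (enum S) S (eval_oracle p) x))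
             in finds_minimal miny \<and>
                (\<exists>z t. groenevelt_impl sfm pick enum S (eval_oracle p) = Some (z, t) \<and>
                       groenevelt pick miny S p = Some z \<and>
                       is_arg_min (square_sum S) (\<lambda>x. x \<in> M_convex_set S p) z \<and>
                       decreasingly_minimal S (M_convex_set S p) z \<and>
                       t \<le> poly \<pi> (card S))))"
    (is "?correct \<and> ?polynomial")
proof
  show correct: ?correct
    using groenevelt_level_certified level_certified_optimal by metis
  obtain \<sigma> where sfm: "sfm_bound sfm \<sigma>"
    using assms unfolding strongly_polynomial_sfm_def sfm_bound_def by blast
  show ?polynomial
  \<comment> \<open>One query to \<open>p\<close> costs one operation, so the recursion starts with \<open>N = |S| + 1\<close>.\<close>
  proof (intro exI[of _ "[:0, 2:] * pcompose (call_poly \<sigma>) [:1, 1:]"] allI impI, elim conjE)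
    fix pick :: "'a set \<Rightarrow> nat \<Rightarrow> 'a set" and enum :: "'a set \<Rightarrow> 'a list" and S :: "'a set" and p :: "'a set \<Rightarrow> int extended"
    assume A: "valid_choice pick" "valid_enum enum" "finite S" "S \<noteq> {}" "supermodular_on S p"
    let ?miny = "\<lambda>S p x. result (greedy_minimal sfm (enum S) S (eval_oracle p) x)"
    have eval: "(\<lambda>X. result (eval_oracle p X)) = p" "\<forall>X\<subseteq>S. ops (eval_oracle p X) \<le> 1"
      by (auto simp: eval_oracle_def)
    have miny: "finds_minimal ?miny"
      by (rule greedy_finds_minimal[OF sfm A(2)])
    obtain z t where zt: "groenevelt_impl sfm pick enum S (eval_oracle p) = Some (z, t)"
        "groenevelt pick ?miny S p = Some z"
        "t + poly (call_poly \<sigma>) (1 + card S) \<le> 2 * card S * poly (call_poly \<sigma>) (1 + card S)"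
      using groenevelt_impl_simulates[OF sfm A(1-4), of "eval_oracle p", unfolded eval(1), OF A(5) eval(2) order_refl]
      by blast
    have "is_arg_min (square_sum S) (\<lambda>x. x \<in> M_convex_set S p) z \<and>
        decreasingly_minimal S (M_convex_set S p) z"
      using correct A miny zt(2) by fastforce
    moreover have "t \<le> poly ([:0, 2:] * pcompose (call_poly \<sigma>) [:1, 1:]) (card S)"
      using zt(3) by (simp add: poly_pcompose)
    ultimately show "let miny = ?miny in finds_minimal miny \<and>
        (\<exists>z t. groenevelt_impl sfm pick enum S (eval_oracle p) = Some (z, t) \<and>
               groenevelt pick miny S p = Some z \<and>
               is_arg_min (square_sum S) (\<lambda>x. x \<in> M_convex_set S p) z \<and>
               decreasingly_minimal S (M_convex_set S p) z \<and>
               t \<le> poly ([:0, 2:] * pcompose (call_poly \<sigma>) [:1, 1:]) (card S))"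
      unfolding Let_def using miny zt(1,2) by blast
  qed
qed

end
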